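(* Let $q$ be a power of an odd prime $p$, let $\phi$ be the quadratic character on $\mathbb{F}_q$, and let $$Z = \sum_{j,x \in \mathbb{F}_q^*} \phi(jx)\,\phi(1-x)\,\phi\big(x(j+1)^2 + (j-1)^2\big).$$ (i) When $q \equiv 7 \pmod 8$, we have $Z = 2q$. (ii) When $q \equiv 3 \pmod 8$, we have $Z = 2u$, where $|u|, |v|$ is the unique pair of positive integers with $p \nmid u$ for which $q^2 = u^2 + 2v^2$, and where the sign of $u$ is determined by the congruence $u \equiv -1 \pmod 8$. (iii) In particular, when $q = p \equiv 3 \pmod 8$, we have $Z = 4a_8^2 - 2p$, where $p = a_8^2 + 2b_8^2$ with integers $a_8, b_8$.
   Context: The quadratic character $\phi$ on $\mathbb{F}_q$ is extended by $\phi(0) = 0$. *)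

theory Defs
  imports "HOL-Number_Theory.Number_Theory" "HOL-Library.Cardinality"
begin

text \<open>
  A finite field \<open>\<bbbF>\<^sub>q\<close> is a type \<open>'a :: {field, finite}\<close> with \<open>CARD('a) = q\<close>.
  The values of the quadratic character are taken in the integers.
\<close>

definition quad_char :: "'a::field \<Rightarrow> int" where
  "quad_char x = (if x = 0 then 0 else if \<exists>y. x = y ^ 2 then 1 else - 1)"

end

theory Submission
  imports Defs "HOL-Computational_Algebra.Polynomial"
begin

text \<open>
  Let \<open>q\<close> be the number of elements of the field. In all cases \<open>q \<equiv> 3 (mod 4)\<close>, so \<open>\<chi> (- 1) = - 1\<close>,
  where \<open>\<chi>\<close> is the quadratic character. The inner sum of \<open>Z\<close> counts points on an elliptic curve with
  full two-torsion, and \<open>Z\<close> adds these counts over a one-parameter family. The proof uses only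
  two-isogenies of these curves, in the form of an identity between two character sums
  (\<open>quad_char_isogeny\<close>), and the arithmetic of the circle \<open>x\<^sup>2 + y\<^sup>2 = 1\<close> over the field.

  Reduction. Put \<open>K c = (\<Sum>s. \<chi> (s (s - 1) (s - c\<^sup>2)))\<close> and \<open>L = (\<Sum>c. \<chi> (c + 1) K c)\<close>
  (\<open>legendre_sum\<close>, \<open>legendre_moment\<close>). A change of the variable \<open>j\<close> makes \<open>Z\<close> a sum over \<open>w\<close> of a function of
  \<open>w\<^sup>2\<close>, hence a sum over \<open>z\<close> with weight \<open>1 + \<chi> z\<close>. The part with \<open>\<chi> z\<close> is symmetric in the two
  variables; in terms of their sum and their product it becomes a family that is isogenous to the curves of \<open>K\<close>.
  The result is \<open>Z = q (1 + \<chi> 2) - L\<close> (\<open>double_sum_eq_legendre_moment\<close>).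

  The case \<open>q \<equiv> 7 (mod 8)\<close>. A second isogeny shows that \<open>K\<close> changes sign under the involution
  \<open>c \<mapsto> (1 - c) / (1 + c)\<close>, so \<open>L = - \<chi> 2 * L\<close> (\<open>legendre_moment_eq\<close>). Here \<open>\<chi> 2 = 1\<close>, so \<open>L = 0\<close> and \<open>Z = 2 q\<close>.

  The case \<open>q \<equiv> 3 (mod 8)\<close>. Now \<open>\<chi> 2 = - 1\<close> and \<open>Z = - L\<close>. Adjoin \<open>i\<close> with \<open>i\<^sup>2 = - 1\<close>. The circle \<open>U\<close> is
  a group of order \<open>q + 1 = 4 N\<close> with \<open>N\<close> odd, and it is the product of \<open>{1, - 1, i, - i}\<close> and
  a subgroup \<open>V\<close> of order \<open>N\<close>. If \<open>re\<close> is viewed as a cosine, then \<open>2 L\<close> is the sum of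
  \<open>\<chi> (re (u\<^sup>4) + re w)\<close> over all \<open>u\<close> and \<open>w\<close> in \<open>U\<close>. The product formula for cosines splits such sums: with an
  eighth root of unity \<open>\<zeta>\<close>, \<open>A = (\<Sum>v\<in>V. \<chi> (re v))\<close> and \<open>B = (\<Sum>v\<in>V. \<chi> (re (\<zeta> v)))\<close> one gets
  \<open>L = 4 B\<^sup>2 - 2 A\<^sup>2\<close> (\<open>legendre_moment_eq_cos_sums\<close>). The same double sum, taken with the sign that tells the
  squares of \<open>U\<close> from the other elements, gives \<open>A\<^sup>2 + 2 B\<^sup>2 = q\<close> (\<open>card_eq_cos_sums\<close>). So
  \<open>Z = 4 A\<^sup>2 - 2 q = 2 u\<close> with \<open>u = 2 A\<^sup>2 - q\<close>, and \<open>u\<^sup>2 + 2 (2 A B)\<^sup>2 = q\<^sup>2\<close>. Since \<open>A\<close> is odd, \<open>u \<equiv> - 1 (mod 8)\<close>.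

  It remains to see that \<open>p\<close> does not divide \<open>A\<close>, and that this determines \<open>A\<^sup>2\<close> and \<open>u\<^sup>2\<close>. Euler's criterion and
  the binomial theorem express \<open>A\<close> modulo \<open>p\<close> by the binomial coefficient of \<open>(q - 1) / 2\<close> over
  \<open>(q - 3) / 8\<close> (\<open>cos_sum_cong_binomial\<close>), and Lucas' congruence shows that it is not divisible by \<open>p\<close>. A
  power of \<open>p\<close> has at most one representation \<open>a\<^sup>2 + 2 b\<^sup>2\<close> with \<open>p\<close> not dividing \<open>a\<close>, up to signs
  (\<open>square_eq_if_same_norm\<close>).
\<close>

section \<open>The quadratic character of a finite field\<close>

notation quad_char (\<open>\<chi>\<close>)

lemma finite_field_power_card_minus_1:
  fixes x :: "'a::{field,finite}"
  assumes "x \<noteq> 0"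
  shows "x ^ (CARD('a) - 1) = 1"
proof -
  let ?S = "UNIV - {0::'a}"
  have "bij_betw ((*) x) ?S ?S"
    by (rule bij_betw_byWitness[where f' = "(*) (inverse x)"]) (use assms in auto)
  then have "(\<Prod>y\<in>?S. x * y) = \<Prod>?S"
    by (rule prod.reindex_bij_betw)
  moreover have "(\<Prod>y\<in>?S. x * y) = x ^ card ?S * \<Prod>?S"
    by (simp add: prod.distrib)
  moreover have "\<Prod>?S \<noteq> 0"
    by simp
  moreover have "card ?S = CARD('a) - 1"
    by (simp add: card_Diff_subset)
  ultimately show ?thesis by simp
qed

lemma quad_char_0 [simp]: "quad_char 0 = 0"
  by (simp add: quad_char_def)

lemma quad_char_1 [simp]: "quad_char (1::'a::field) = 1"
  by (auto simp: quad_char_def intro: exI[of _ 1])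

lemma quad_char_eq_0_iff [simp]: "quad_char x = 0 \<longleftrightarrow> x = 0"
  by (auto simp: quad_char_def)

lemma quad_char_cases: "quad_char x \<in> {-1, 0, 1}"
  by (auto simp: quad_char_def)

lemma quad_char_square [simp]: "quad_char (x ^ 2) = (if x = 0 then 0 else 1)"
  by (auto simp: quad_char_def)

lemma two_neq_0_if_odd_card:
  assumes "odd CARD('a::{field,finite})"
  shows "(2::'a) \<noteq> 0"
proof
  assume "(2::'a) = 0"
  then have "of_nat 2 = (0::'a)" by simp
  then have "CHAR('a) dvd 2"
    by (simp only: of_nat_eq_0_iff_char_dvd)
  moreover have "CHAR('a) \<noteq> 1" by simp
  ultimately have "CHAR('a) = 2"
    using prime_nat_iff two_is_prime_nat by blast
  then show False
    using CHAR_dvd_CARD[where 'a='a] assms by auto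
qed

lemma card_square_roots:
  fixes x :: "'a::{field,finite}"
  assumes "odd CARD('a)"
  shows "int (card {y. y ^ 2 = x}) = 1 + \<chi> x"
proof (cases "\<exists>y. x = y ^ 2")
  case False
  then show ?thesis by (auto simp: quad_char_def)
next
  case True
  then obtain y where y: "x = y ^ 2" by blast
  have set: "{z. z ^ 2 = x} = {y, -y}"
    using y by (auto simp: power2_eq_iff)
  show ?thesis
  proof (cases "y = 0")
    case True
    then show ?thesis using set y by simp
  next
    case False
    then have "y \<noteq> - y"
      using two_neq_0_if_odd_card[OF assms] by (metis add.right_inverse mult_2 mult_eq_0_iff)
    then show ?thesis using set y False by simp
  qed
qed

lemma sum_fibers:
  fixes f :: "'b::finite \<Rightarrow> int"
  assumes "finite S"
  shows "(\<Sum>x\<in>S. f (g x)) = (\<Sum>r\<in>UNIV. int (card {x\<in>S. g x = r}) * f r)"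
proof -
  have "(\<Sum>x\<in>S. f (g x)) = (\<Sum>r\<in>UNIV. \<Sum>x\<in>{x\<in>S. g x = r}. f (g x))"
    by (rule sum.group[symmetric]) (use assms in auto)
  also have "\<dots> = (\<Sum>r\<in>UNIV. \<Sum>x\<in>{x\<in>S. g x = r}. f r)"
    by (intro sum.cong) auto
  finally show ?thesis by simp
qed

lemma sum_squares:
  fixes f :: "'a::{field,finite} \<Rightarrow> int"
  assumes "odd CARD('a)"
  shows "(\<Sum>y\<in>UNIV. f (y ^ 2)) = (\<Sum>x\<in>UNIV. (1 + \<chi> x) * f x)"
  by (subst sum_fibers) (simp_all add: card_square_roots[OF assms])

lemma bij_affine:
  fixes a :: "'a::field"
  assumes "a \<noteq> 0"
  shows "bij (\<lambda>x. a * x + b)"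
  by (rule bij_betw_byWitness[where f' = "\<lambda>x. (x - b) / a"]) (use assms in auto)

lemma sum_affine:
  fixes a :: "'a::field"
  assumes "a \<noteq> 0"
  shows "(\<Sum>x\<in>UNIV. f x) = (\<Sum>x\<in>UNIV. f (a * x + b))"
  by (rule sum.reindex_bij_betw[OF bij_affine[OF assms], symmetric])

lemma sum_quad_char:
  assumes "odd CARD('a::{field,finite})"
  shows "(\<Sum>x\<in>(UNIV::'a set). \<chi> x) = 0"
  using sum_squares[OF assms, of "\<lambda>_. 1"] by (simp add: sum.distrib)

text \<open>
  The nonzero squares are the image of a two-to-one map, so there are \<open>(q - 1) / 2\<close> of them. They are roots of
  \<open>X ^ ((q - 1) / 2) - 1\<close>, which has no room for further roots.
\<close>

lemma euler_criterion:
  fixes x :: "'a::{field,finite}"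
  assumes "odd CARD('a)"
  shows "of_int (\<chi> x) = x ^ ((CARD('a) - 1) div 2)"
proof -
  define m where "m = (CARD('a) - 1) div 2"
  have card: "CARD('a) = 2 * m + 1"
    using assms by (auto simp: m_def elim: oddE)
  have "card {0, 1::'a} \<le> CARD('a)"
    by (intro card_mono) auto
  then have "m > 0" using card by simp
  let ?Sq = "{x::'a. x \<noteq> 0 \<and> (\<exists>y. x = y ^ 2)}" and ?R = "{x::'a. poly (Polynomial.monom 1 m - 1) x = 0}"
  have sq: "x ^ m = 1" if "x \<in> ?Sq" for x
  proof -
    from that obtain y where y: "x = y ^ 2" "y \<noteq> 0" by auto
    then have "x ^ m = y ^ (CARD('a) - 1)" by (simp add: card power_mult)
    then show ?thesis using finite_field_power_card_minus_1[OF y(2)] by simp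
  qed
  have "(\<Sum>x\<in>(UNIV::'a set). (1 + \<chi> x)) = int CARD('a)"
    using sum_squares[OF assms, of "\<lambda>_. 1"] by simp
  also have "(\<Sum>x\<in>(UNIV::'a set). (1 + \<chi> x)) = (\<Sum>x\<in>UNIV. (if x \<in> ?Sq then 2 else 0) + (if x = 0 then 1 else 0))"
    by (intro sum.cong) (auto simp: quad_char_def)
  also have "\<dots> = 2 * int (card ?Sq) + 1"
    by (simp add: sum.distrib sum.If_cases)
  finally have cSq: "card ?Sq = m" using card by linarith
  have ne: "Polynomial.monom 1 m - 1 \<noteq> (0 :: 'a poly)"
  proof
    assume "Polynomial.monom 1 m - 1 = (0 :: 'a poly)"
    then have "Polynomial.coeff (Polynomial.monom 1 m - 1 :: 'a poly) m = 0" by simp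
    then show False using \<open>m > 0\<close> by simp
  qed
  have "Polynomial.degree (Polynomial.monom 1 m - 1 :: 'a poly) \<le> m"
    by (rule degree_diff_le) (auto simp: degree_monom_le)
  then have "card ?R \<le> m"
    using card_poly_roots_bound[OF ne] by linarith
  moreover have sub: "?Sq \<subseteq> ?R"
    using sq by (auto simp: poly_monom)
  ultimately have "?Sq = ?R"
    using cSq by (intro card_seteq) auto
  then have iff: "x \<in> ?Sq \<longleftrightarrow> x ^ m = 1" for x
    by (auto simp: poly_monom)
  have "of_int (\<chi> x) = x ^ m"
  proof (cases "x = 0")
    case True
    then show ?thesis using \<open>m > 0\<close> by (simp add: power_0_left)
  next
    case False
    have "(x ^ m) ^ 2 = 1"
      using finite_field_power_card_minus_1[OF False] card by (simp add: power_mult mult.commute)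
    then have "x ^ m = 1 \<or> x ^ m = -1" by (simp add: power2_eq_1_iff)
    then show ?thesis
      using iff[of x] False by (auto simp: quad_char_def)
  qed
  then show ?thesis by (simp add: m_def)
qed

text \<open>
  In odd characteristic the integers \<open>- 1, 0, 1\<close> stay distinct in the field, so a value of \<open>\<chi>\<close> can be
  computed there, where Euler's criterion applies.
\<close>

lemma quad_char_eqI:
  fixes x :: "'a::{field,finite}"
  assumes "odd CARD('a)" and "b \<in> {-1, 0, 1}" and "(of_int (\<chi> x) :: 'a) = of_int b"
  shows "\<chi> x = b"
proof -
  have "(1::'a) \<noteq> -1"
    using two_neq_0_if_odd_card[OF assms(1)]
    by (metis add.right_inverse one_add_one)
  then show ?thesis using assms(2,3) quad_char_cases[of x] by auto
qed

lemma quad_char_mult: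
  fixes x y :: "'a::{field,finite}"
  assumes "odd CARD('a)"
  shows "\<chi> (x * y) = \<chi> x * \<chi> y"
proof -
  have "(of_int (\<chi> (x * y)) :: 'a) = of_int (\<chi> x * \<chi> y)"
    by (simp add: euler_criterion[OF assms] power_mult_distrib)
  moreover have "\<chi> x * \<chi> y \<in> {-1, 0, 1}"
    using quad_char_cases[of x] quad_char_cases[of y] by auto
  ultimately show ?thesis by (intro quad_char_eqI[OF assms])
qed

lemma quad_char_minus_1:
  assumes "CARD('a::{field,finite}) mod 4 = 3"
  shows "\<chi> (-1 :: 'a) = -1"
proof -
  have odd: "odd CARD('a)" using assms by presburger
  have "odd ((CARD('a) - 1) div 2)" using assms by presburger
  then have "(of_int (\<chi> (-1::'a)) :: 'a) = of_int (-1)"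
    using euler_criterion[OF odd, of "-1"] by simp
  then show ?thesis by (intro quad_char_eqI[OF odd]) auto
qed

lemma quad_char_minus:
  fixes x :: "'a::{field,finite}"
  assumes "CARD('a) mod 4 = 3"
  shows "\<chi> (- x) = - \<chi> x"
proof -
  have "odd CARD('a)" using assms by presburger
  from quad_char_mult[OF this, of "-1" x] show ?thesis
    by (simp add: quad_char_minus_1[OF assms])
qed

lemma quad_char_sq [simp]: "quad_char x * quad_char x = (if x = 0 then 0 else 1)"
  by (auto simp: quad_char_def)

lemma quad_char_inverse:
  fixes x :: "'a::{field,finite}"
  assumes "odd CARD('a)"
  shows "\<chi> (inverse x) = \<chi> x"
proof (cases "x = 0")
  case False
  have "\<chi> x * \<chi> (inverse x) = 1"
    using False by (simp flip: quad_char_mult[OF assms])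
  then show ?thesis
    using quad_char_cases[of x] quad_char_cases[of "inverse x"] by auto
qed auto

lemma quad_char_divide:
  fixes x :: "'a::{field,finite}"
  assumes "odd CARD('a)"
  shows "\<chi> (x / y) = \<chi> x * \<chi> y"
  by (simp add: divide_inverse quad_char_mult[OF assms] quad_char_inverse[OF assms])

section \<open>Character sums of linear and quadratic polynomials\<close>

lemma sum_quad_char_linear:
  fixes c :: "'a::{field,finite}"
  assumes "odd CARD('a)" "c \<noteq> 0"
  shows "(\<Sum>x\<in>UNIV. \<chi> (c * x + d)) = 0"
  using sum_affine[OF assms(2), of \<chi> d] sum_quad_char[OF assms(1)] by simp

lemma sum_UNIV_split:
  fixes f :: "'a::finite \<Rightarrow> 'b::ab_group_add"
  shows "sum f UNIV = f a + sum f (UNIV - {a})"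
  by (rule sum.remove) auto

text \<open>
  For \<open>a \<noteq> b\<close> a shift gives \<open>\<chi> (x (x + c))\<close> with \<open>c \<noteq> 0\<close>. For \<open>x \<noteq> 0\<close> this is \<open>\<chi> (1 + c / x)\<close>, and
  \<open>1 + c / x\<close> takes each value but \<open>1\<close> exactly once.
\<close>

lemma sum_quad_char_quadratic:
  fixes a b :: "'a::{field,finite}"
  assumes odd: "odd CARD('a)"
  shows "(\<Sum>x\<in>UNIV. \<chi> (x + a) * \<chi> (x + b)) = (if a = b then int CARD('a) - 1 else - 1)"
proof (cases "a = b")
  case True
  have "(\<Sum>x\<in>UNIV. \<chi> (x + a) * \<chi> (x + b)) = (\<Sum>x\<in>UNIV. if x = -a then 0 else 1)"
    using True by (intro sum.cong) (auto simp: eq_neg_iff_add_eq_0)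
  also have "\<dots> = int (card (UNIV - {-a}))"
    by (simp add: sum.If_cases Compl_eq_Diff_UNIV)
  also have "\<dots> = int CARD('a) - 1"
    by (simp add: card_Diff_subset of_nat_diff)
  finally show ?thesis using True by simp
next
  case False
  define c where "c = b - a"
  have c: "c \<noteq> 0" using False by (simp add: c_def)
  have "(\<Sum>x\<in>UNIV. \<chi> (x + a) * \<chi> (x + b)) = (\<Sum>x\<in>UNIV. \<chi> x * \<chi> (x + c))"
    by (subst sum_affine[of 1 _ "-a"]) (simp_all add: c_def algebra_simps)
  also have "\<dots> = (\<Sum>x\<in>UNIV - {0}. \<chi> x * \<chi> (x + c))"
    by (subst sum_UNIV_split[of _ 0]) simp
  also have "\<dots> = (\<Sum>x\<in>UNIV - {0}. \<chi> (c * x + 1))"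
  proof (rule sum.reindex_bij_witness[of _ inverse inverse])
    fix x :: 'a assume x: "x \<in> UNIV - {0}"
    then have "c * inverse x + 1 = (x + c) / x" by (simp add: field_simps)
    then show "\<chi> (c * inverse x + 1) = \<chi> x * \<chi> (x + c)"
      by (simp add: quad_char_divide[OF odd])
  qed auto
  also have "\<dots> = (\<Sum>x\<in>UNIV. \<chi> (c * x + 1)) - 1"
    by (subst sum_UNIV_split[of _ 0]) simp
  finally show ?thesis using False sum_quad_char_linear[OF odd c] by simp
qed

lemma card_quadratic_roots:
  fixes r n :: "'a::{field,finite}"
  assumes odd: "odd CARD('a)"
  shows "int (card {x. x ^ 2 - r * x + n = 0}) = 1 + \<chi> (r ^ 2 - 4 * n)"
proof -
  note two = two_neq_0_if_odd_card[OF odd]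
  have four: "(4::'a) \<noteq> 0"
  proof
    assume "(4::'a) = 0"
    moreover have "(4::'a) = 2 * 2" by simp
    ultimately show False using two by (simp only: mult_eq_0_iff) simp
  qed
  have eq: "x ^ 2 - r * x + n = 0 \<longleftrightarrow> (2 * x - r) ^ 2 = r ^ 2 - 4 * n" for x
  proof -
    have "x ^ 2 - r * x + n = 0 \<longleftrightarrow> 4 * (x ^ 2 - r * x + n) = 0"
      unfolding mult_eq_0_iff using four by simp
    also have "4 * (x ^ 2 - r * x + n) = (2 * x - r) ^ 2 - (r ^ 2 - 4 * n)"
      by (simp add: power2_eq_square algebra_simps)
    finally show ?thesis by simp
  qed
  have half: "2 * (y / 2) = y" "2 * y / 2 = y" for y :: 'a
    using two by (simp_all only: times_divide_eq_right nonzero_mult_div_cancel_left not_False_eq_True)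
  have inv: "2 * ((y + r) / 2) - r = y" "(2 * y - r + r) / 2 = y" for y
    by (simp_all only: half diff_add_cancel add_diff_cancel_right')
  have "bij_betw (\<lambda>x. 2 * x - r) {x. x ^ 2 - r * x + n = 0} {y. y ^ 2 = r ^ 2 - 4 * n}"
  proof (rule bij_betw_byWitness[where f' = "\<lambda>y. (y + r) / 2"])
    show "\<forall>a\<in>{x. x ^ 2 - r * x + n = 0}. (2 * a - r + r) / 2 = a"
      and "\<forall>a\<in>{y. y ^ 2 = r ^ 2 - 4 * n}. 2 * ((a + r) / 2) - r = a"
      using inv by blast+
    show "(\<lambda>x. 2 * x - r) ` {x. x ^ 2 - r * x + n = 0} \<subseteq> {y. y ^ 2 = r ^ 2 - 4 * n}"
      using eq by blast
    show "(\<lambda>y. (y + r) / 2) ` {y. y ^ 2 = r ^ 2 - 4 * n} \<subseteq> {x. x ^ 2 - r * x + n = 0}"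
      by (rule image_subsetI) (simp only: eq inv mem_Collect_eq)
  qed
  then have "card {x. x ^ 2 - r * x + n = 0} = card {y. y ^ 2 = r ^ 2 - 4 * n}"
    by (rule bij_betw_same_card)
  then show ?thesis
    by (simp only: card_square_roots[OF odd])
qed

section \<open>Two-isogenies\<close>

lemma odd_if_3_mod_4: "(q::nat) mod 4 = 3 \<Longrightarrow> odd q"
  by presburger

lemma sum_UNIV_diff_zero:
  fixes f :: "'a::finite \<Rightarrow> 'b::ab_group_add"
  assumes "f a = 0"
  shows "sum f (UNIV - {a}) = sum f UNIV"
  using sum_UNIV_split[of f a] assms by simp

text \<open>
  The curves \<open>y\<^sup>2 = x (x\<^sup>2 + m x + n)\<close> and \<open>y\<^sup>2 = x (x\<^sup>2 - 2 m x + m\<^sup>2 - 4 n)\<close> are two-isogenous and so have equally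
  many points. Directly: if \<open>n \<noteq> 0\<close>, the left-hand summand depends only on \<open>r = x + n / x\<close>, namely
  as \<open>\<chi> (r + m)\<close>, and \<open>r\<close> arises from \<open>1 + \<chi> (r\<^sup>2 - 4 n)\<close> values of \<open>x\<close>. The sum with the constant weight vanishes,
  and \<open>r \<mapsto> r - m\<close> turns the rest into the right-hand side. If \<open>n = 0\<close>, both sides are \<open>- \<chi> m\<close>.
\<close>

lemma quad_char_isogeny:
  fixes m n :: "'a::{field,finite}"
  assumes odd: "odd CARD('a)"
  shows "(\<Sum>x\<in>UNIV. \<chi> x * \<chi> (x ^ 2 + m * x + n))
       = (\<Sum>x\<in>UNIV. \<chi> x * \<chi> (x ^ 2 - 2 * m * x + (m ^ 2 - 4 * n)))"
proof (cases "n = 0")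
  case True
  have "(\<Sum>x\<in>UNIV. \<chi> x * \<chi> (x ^ 2 + m * x + n)) = (\<Sum>x\<in>UNIV. \<chi> (x + m) - (if x = 0 then \<chi> m else 0))"
  proof (intro sum.cong refl)
    fix x
    have "x ^ 2 + m * x + n = x * (x + m)"
      using True by (simp add: power2_eq_square algebra_simps)
    then show "\<chi> x * \<chi> (x ^ 2 + m * x + n) = \<chi> (x + m) - (if x = 0 then \<chi> m else 0)"
      by (simp only: quad_char_mult[OF odd] mult.assoc[symmetric] quad_char_sq) simp
  qed
  also have "\<dots> = - \<chi> m"
    using sum_quad_char_linear[OF odd, of 1 m] by (simp add: sum_subtractf)
  also have "\<dots> = (\<Sum>x\<in>UNIV. \<chi> x - (if x = m then \<chi> m else 0))"
    by (simp add: sum_subtractf sum_quad_char[OF odd])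
  also have "\<dots> = (\<Sum>x\<in>UNIV. \<chi> x * \<chi> (x ^ 2 - 2 * m * x + (m ^ 2 - 4 * n)))"
  proof (intro sum.cong refl)
    fix x
    have "x ^ 2 - 2 * m * x + (m ^ 2 - 4 * n) = (x - m) ^ 2"
      using True by (simp add: power2_eq_square algebra_simps)
    then show "\<chi> x - (if x = m then \<chi> m else 0) = \<chi> x * \<chi> (x ^ 2 - 2 * m * x + (m ^ 2 - 4 * n))"
      by simp
  qed
  finally show ?thesis .
next
  case False
  have "(\<Sum>x\<in>UNIV. \<chi> x * \<chi> (x ^ 2 + m * x + n)) = (\<Sum>x\<in>UNIV - {0}. \<chi> x * \<chi> (x ^ 2 + m * x + n))"
    by (subst sum_UNIV_split[of _ 0]) simp
  also have "\<dots> = (\<Sum>x\<in>UNIV - {0}. \<chi> ((x + n / x) + m))"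
  proof (intro sum.cong refl)
    fix x :: 'a assume "x \<in> UNIV - {0}"
    then have "(x + n / x) + m = (x ^ 2 + m * x + n) / x"
      by (simp add: power2_eq_square field_simps)
    then show "\<chi> x * \<chi> (x ^ 2 + m * x + n) = \<chi> ((x + n / x) + m)"
      by (simp only: quad_char_divide[OF odd] mult.commute)
  qed
  also have "\<dots> = (\<Sum>r\<in>UNIV. int (card {x \<in> UNIV - {0}. x + n / x = r}) * \<chi> (r + m))"
    by (rule sum_fibers) simp
  also have "\<dots> = (\<Sum>r\<in>UNIV. (1 + \<chi> (r ^ 2 - 4 * n)) * \<chi> (r + m))"
  proof (intro sum.cong refl)
    fix r
    have "{x \<in> UNIV - {0}. x + n / x = r} = {x. x ^ 2 - r * x + n = 0}"
    proof (intro Collect_cong)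
      fix x
      show "x \<in> UNIV - {0} \<and> x + n / x = r \<longleftrightarrow> x ^ 2 - r * x + n = 0"
      proof (cases "x = 0")
        case True
        then show ?thesis using False by simp
      next
        case x: False
        then have "x + n / x = r \<longleftrightarrow> x * x + n = r * x"
          by (simp add: field_simps)
        then show ?thesis using x by (simp add: power2_eq_square) (metis add_diff_eq diff_add_eq eq_iff_diff_eq_0)
      qed
    qed
    then show "int (card {x \<in> UNIV - {0}. x + n / x = r}) * \<chi> (r + m) = (1 + \<chi> (r ^ 2 - 4 * n)) * \<chi> (r + m)"
      by (simp only: card_quadratic_roots[OF odd])
  qed
  also have "\<dots> = (\<Sum>r\<in>UNIV. \<chi> (r + m) * \<chi> (r ^ 2 - 4 * n))"
    using sum_quad_char_linear[OF odd, of 1 m] by (simp add: algebra_simps sum.distrib)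
  also have "\<dots> = (\<Sum>x\<in>UNIV. \<chi> (x + - m + m) * \<chi> ((x + - m) ^ 2 - 4 * n))"
    by (subst sum_affine[of 1 _ "- m"]) simp_all
  also have "\<dots> = (\<Sum>x\<in>UNIV. \<chi> x * \<chi> (x ^ 2 - 2 * m * x + (m ^ 2 - 4 * n)))"
    by (intro sum.cong refl arg_cong2[where f = "(*)"] arg_cong[where f = \<chi>])
       (simp_all add: power2_eq_square algebra_simps)
  finally show ?thesis .
qed

text \<open>
  If the nonzero roots of the cubic are \<open>- a\<^sup>2\<close> and \<open>- b\<^sup>2\<close>, then \<open>m\<^sup>2 - 4 n = (a\<^sup>2 - b\<^sup>2)\<^sup>2\<close>, and the cubic of the isogenous
  curve splits as well.
\<close>

lemma quad_char_isogeny_split: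
  fixes a b :: "'a::{field,finite}"
  assumes odd: "odd CARD('a)"
  shows "(\<Sum>x\<in>UNIV. \<chi> x * \<chi> (x + a ^ 2) * \<chi> (x + b ^ 2))
       = (\<Sum>x\<in>UNIV. \<chi> x * \<chi> (x - (a - b) ^ 2) * \<chi> (x - (a + b) ^ 2))"
proof -
  have "(\<Sum>x\<in>UNIV. \<chi> x * \<chi> (x + a ^ 2) * \<chi> (x + b ^ 2))
      = (\<Sum>x\<in>UNIV. \<chi> x * \<chi> (x ^ 2 + (a ^ 2 + b ^ 2) * x + a ^ 2 * b ^ 2))"
  proof (intro sum.cong refl)
    fix x
    have "(x + a ^ 2) * (x + b ^ 2) = x ^ 2 + (a ^ 2 + b ^ 2) * x + a ^ 2 * b ^ 2"
      by (simp add: power2_eq_square algebra_simps)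
    then show "\<chi> x * \<chi> (x + a ^ 2) * \<chi> (x + b ^ 2) = \<chi> x * \<chi> (x ^ 2 + (a ^ 2 + b ^ 2) * x + a ^ 2 * b ^ 2)"
      by (simp flip: quad_char_mult[OF odd] add: mult.assoc)
  qed
  also have "\<dots> = (\<Sum>x\<in>UNIV. \<chi> x * \<chi> (x ^ 2 - 2 * (a ^ 2 + b ^ 2) * x + ((a ^ 2 + b ^ 2) ^ 2 - 4 * (a ^ 2 * b ^ 2))))"
    by (rule quad_char_isogeny[OF odd])
  also have "\<dots> = (\<Sum>x\<in>UNIV. \<chi> x * \<chi> (x - (a - b) ^ 2) * \<chi> (x - (a + b) ^ 2))"
  proof (intro sum.cong refl)
    fix x
    have "x ^ 2 - 2 * (a ^ 2 + b ^ 2) * x + ((a ^ 2 + b ^ 2) ^ 2 - 4 * (a ^ 2 * b ^ 2))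
        = (x - (a - b) ^ 2) * (x - (a + b) ^ 2)"
      by (simp add: power2_eq_square algebra_simps)
    then show "\<chi> x * \<chi> (x ^ 2 - 2 * (a ^ 2 + b ^ 2) * x + ((a ^ 2 + b ^ 2) ^ 2 - 4 * (a ^ 2 * b ^ 2)))
        = \<chi> x * \<chi> (x - (a - b) ^ 2) * \<chi> (x - (a + b) ^ 2)"
      by (simp only: quad_char_mult[OF odd] mult.assoc)
  qed
  finally show ?thesis .
qed

section \<open>The Legendre family and its twisted moment\<close>

definition legendre_sum :: "'a::{field,finite} \<Rightarrow> int" where
  "legendre_sum c = (\<Sum>s\<in>UNIV. \<chi> s * \<chi> (s - 1) * \<chi> (s - c ^ 2))"

text \<open>
  The value depends on the field alone, hence the argument of type \<open>'a itself\<close>.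
\<close>

definition legendre_moment :: "'a::{field,finite} itself \<Rightarrow> int" where
  "legendre_moment _ = (\<Sum>c\<in>UNIV. \<chi> (c + 1 :: 'a) * legendre_sum c)"

lemma legendre_sum_neg: "legendre_sum (- c) = legendre_sum c"
  by (simp add: legendre_sum_def)

lemma legendre_sum_eq_neg:
  fixes c :: "'a::{field,finite}"
  assumes q: "CARD('a) mod 4 = 3"
  shows "(\<Sum>s\<in>UNIV. \<chi> s * \<chi> (s + 1) * \<chi> (s + c ^ 2)) = - legendre_sum c"
proof -
  have "(\<Sum>s\<in>UNIV. \<chi> s * \<chi> (s + 1) * \<chi> (s + c ^ 2))
      = (\<Sum>s\<in>UNIV. \<chi> (- s) * \<chi> (- (s - 1)) * \<chi> (- (s - c ^ 2)))"
    by (subst sum_affine[of "-1" _ 0]) simp_all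
  then show ?thesis
    by (simp only: quad_char_minus[OF q] legendre_sum_def) (simp add: sum_negf)
qed

lemma quad_char_mult_square:
  fixes e x :: "'a::{field,finite}"
  assumes "odd CARD('a)" "e \<noteq> 0"
  shows "\<chi> (e ^ 2 * x) = \<chi> x"
  using assms by (simp add: quad_char_mult)

text \<open>
  The curve with roots \<open>0, - 1, - c\<^sup>2\<close> has the sum \<open>- K c\<close> by \<open>legendre_sum_eq_neg\<close>. The isogeny takes it to
  the roots \<open>0, (1 - c)\<^sup>2, (1 + c)\<^sup>2\<close>, and division by the square \<open>(1 + c)\<^sup>2\<close> returns to Legendre form.
\<close>

lemma legendre_sum_transform:
  fixes c :: "'a::{field,finite}"
  assumes q: "CARD('a) mod 4 = 3" and c: "c \<noteq> - 1"
  shows "legendre_sum ((1 - c) / (1 + c)) = - legendre_sum c"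
proof -
  note odd = odd_if_3_mod_4[OF q]
  define e where "e = 1 + c"
  have e: "e \<noteq> 0" using c by (simp add: e_def add_eq_0_iff)
  have "- legendre_sum c = (\<Sum>s\<in>UNIV. \<chi> s * \<chi> (s + 1 ^ 2) * \<chi> (s + c ^ 2))"
    by (simp add: legendre_sum_eq_neg[OF q])
  also have "\<dots> = (\<Sum>s\<in>UNIV. \<chi> s * \<chi> (s - (1 - c) ^ 2) * \<chi> (s - (1 + c) ^ 2))"
    by (rule quad_char_isogeny_split[OF odd])
  also have "\<dots> = (\<Sum>s\<in>UNIV. \<chi> (e ^ 2 * s) * \<chi> (e ^ 2 * s - (1 - c) ^ 2) * \<chi> (e ^ 2 * s - e ^ 2))"
    by (subst sum_affine[of "e ^ 2" _ 0]) (use e in \<open>simp_all add: e_def\<close>)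
  also have "\<dots> = (\<Sum>s\<in>UNIV. \<chi> (e ^ 2 * s) * \<chi> (e ^ 2 * (s - 1)) * \<chi> (e ^ 2 * (s - ((1 - c) / e) ^ 2)))"
    using e by (intro sum.cong) (simp_all add: right_diff_distrib power_divide)
  also have "\<dots> = legendre_sum ((1 - c) / (1 + c))"
    by (simp only: quad_char_mult_square[OF odd e] legendre_sum_def) (simp add: e_def)
  finally show ?thesis by simp
qed

text \<open>
  The map \<open>c \<mapsto> (1 - c) / (1 + c)\<close> is an involution of the field without \<open>- 1\<close>. It multiplies \<open>\<chi> (c + 1)\<close> by
  \<open>\<chi> 2\<close>, because \<open>1 + c\<close> goes to \<open>2 / (1 + c)\<close>, and it changes the sign of the Legendre sum.
\<close>

lemma legendre_moment_eq:
  assumes q: "CARD('a::{field,finite}) mod 4 = 3"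
  shows "legendre_moment TYPE('a) = - \<chi> (2::'a) * legendre_moment TYPE('a)"
proof -
  note odd = odd_if_3_mod_4[OF q]
  note two = two_neq_0_if_odd_card[OF odd]
  let ?g = "\<lambda>c::'a. (1 - c) / (1 + c)"
  have g1: "1 + ?g c = 2 / (1 + c)" if "c \<noteq> -1" for c
  proof -
    have "1 + c \<noteq> 0" using that by (simp add: add_eq_0_iff)
    then show ?thesis by (simp add: field_simps)
  qed
  have g2: "1 - ?g c = 2 * c / (1 + c)" if "c \<noteq> -1" for c
  proof -
    have "1 + c \<noteq> 0" using that by (simp add: add_eq_0_iff)
    then show ?thesis by (simp add: field_simps)
  qed
  have gne: "?g c \<noteq> -1" if "c \<noteq> -1" for c
  proof
    assume "?g c = -1"
    then have "2 / (1 + c) = 0" using g1[OF that] by simp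
    moreover have "1 + c \<noteq> 0" using that by (simp add: add_eq_0_iff)
    ultimately show False using two by simp
  qed
  have gg: "?g (?g c) = c" if "c \<noteq> -1" for c
  proof -
    have "1 + c \<noteq> 0" using that by (simp add: add_eq_0_iff)
    then show ?thesis
      using two unfolding g1[OF that] g2[OF that] by simp
  qed
  have rem: "legendre_moment TYPE('a) = (\<Sum>c\<in>UNIV - {-1::'a}. \<chi> (c + 1) * legendre_sum c)"
    unfolding legendre_moment_def by (subst sum_UNIV_split[of _ "-1"]) simp
  also have "\<dots> = (\<Sum>c\<in>UNIV - {-1::'a}. - \<chi> (2::'a) * (\<chi> (c + 1) * legendre_sum c))"
  proof (rule sum.reindex_bij_witness[of _ ?g ?g])
    fix c :: 'a assume c: "c \<in> UNIV - {-1}"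
    then show "?g (?g c) = c" "?g c \<in> UNIV - {-1}" using gg gne by auto
    then show "?g (?g c) = c" "?g c \<in> UNIV - {-1}" .
    have "\<chi> (?g c + 1) = \<chi> (2::'a) * \<chi> (c + 1)"
      using g1[of c] c by (simp add: quad_char_divide[OF odd] add.commute)
    then have "\<chi> (?g c + 1) * legendre_sum (?g c) = - \<chi> (2::'a) * \<chi> (c + 1) * legendre_sum c"
      using legendre_sum_transform[OF q] c by simp
    moreover have "\<chi> (2::'a) * \<chi> (2::'a) = 1" using two by simp
    ultimately show "- \<chi> (2::'a) * (\<chi> (?g c + 1) * legendre_sum (?g c)) = \<chi> (c + 1) * legendre_sum c"
      by (simp add: mult.assoc[symmetric])
  qed
  also have "\<dots> = - \<chi> (2::'a) * legendre_moment TYPE('a)"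
    by (simp only: rem sum_distrib_left)
  finally show ?thesis .
qed

section \<open>Reduction of the double sum to the moment\<close>

lemma sum_quad_char_x_1_minus_x:
  assumes q: "CARD('a::{field,finite}) mod 4 = 3"
  shows "(\<Sum>x\<in>(UNIV::'a set). \<chi> x * \<chi> (1 - x)) = 1"
proof -
  have "\<chi> (1 - x) = - \<chi> (x + -1)" for x :: 'a
    using quad_char_minus[OF q, of "x + -1"] by simp
  then have "(\<Sum>x\<in>(UNIV::'a set). \<chi> x * \<chi> (1 - x)) = - (\<Sum>x\<in>(UNIV::'a set). \<chi> (x + 0) * \<chi> (x + -1))"
    by (simp add: sum_negf)
  then show ?thesis
    using sum_quad_char_quadratic[OF odd_if_3_mod_4[OF q], of 0 "-1"] by simp
qed

definition fibre_sum :: "'a::{field,finite} \<Rightarrow> int" where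
  "fibre_sum z = (\<Sum>x\<in>UNIV. \<chi> x * \<chi> (1 - x) * \<chi> (x + z))"

text \<open>
  For \<open>j \<noteq> - 1\<close> put \<open>w = (j - 1) / (j + 1)\<close>. Then \<open>\<chi> j = \<chi> (1 - w\<^sup>2)\<close>, and the last factor is
  \<open>\<chi> (x + w\<^sup>2)\<close> up to the square \<open>(j + 1)\<^sup>2\<close>. The term \<open>j = - 1\<close> contributes \<open>- 1\<close>.
\<close>

lemma double_sum_eq_fibre_sums:
  fixes F :: "'a::{field,finite} \<Rightarrow> 'a \<Rightarrow> int"
  assumes q: "CARD('a) mod 4 = 3"
  shows "(\<Sum>j\<in>UNIV - {0::'a}. \<Sum>x\<in>UNIV - {0::'a}.
            \<chi> (j * x) * \<chi> (1 - x) * \<chi> (x * (j + 1) ^ 2 + (j - 1) ^ 2))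
       = (\<Sum>w\<in>(UNIV::'a set). \<chi> (1 - w ^ 2) * fibre_sum (w ^ 2)) - 1"
proof -
  note odd = odd_if_3_mod_4[OF q]
  note two = two_neq_0_if_odd_card[OF odd]
  define G where "G j = (\<Sum>x\<in>UNIV. \<chi> (j * x) * \<chi> (1 - x) * \<chi> (x * (j + 1) ^ 2 + (j - 1) ^ 2))" for j :: 'a
  have "(\<Sum>j\<in>UNIV - {0::'a}. \<Sum>x\<in>UNIV - {0::'a}.
            \<chi> (j * x) * \<chi> (1 - x) * \<chi> (x * (j + 1) ^ 2 + (j - 1) ^ 2)) = (\<Sum>j\<in>UNIV - {0}. G j)"
    unfolding G_def by (rule sum.cong[OF refl]) (rule sum_UNIV_diff_zero, simp)
  also have "\<dots> = (\<Sum>j\<in>UNIV. G j)"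
    by (rule sum_UNIV_diff_zero) (simp add: G_def)
  also have "\<dots> = G (-1) + (\<Sum>j\<in>UNIV - {-1}. G j)"
    by (rule sum_UNIV_split)
  also have "G (-1) = -1"
  proof -
    have "G (-1) = (\<Sum>x\<in>(UNIV::'a set). - (\<chi> x * \<chi> (1 - x)))"
      unfolding G_def
    proof (rule sum.cong[OF refl])
      fix x :: 'a
      have "(x * (-1 + 1) ^ 2 + (-1 - 1) ^ 2 :: 'a) = 2 ^ 2" by simp
      then have "\<chi> (x * (-1 + 1) ^ 2 + (-1 - 1) ^ 2 :: 'a) = 1"
        using two by (simp only: quad_char_square) simp
      then show "\<chi> (-1 * x) * \<chi> (1 - x) * \<chi> (x * (-1 + 1) ^ 2 + (-1 - 1) ^ 2) = - (\<chi> x * \<chi> (1 - x))"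
        by (simp add: quad_char_minus[OF q])
    qed
    then show ?thesis
      using sum_quad_char_x_1_minus_x[OF q] by (simp add: sum_negf)
  qed
  also have "(\<Sum>j\<in>UNIV - {-1}. G j) = (\<Sum>w\<in>UNIV - {1::'a}. \<chi> (1 - w ^ 2) * fibre_sum (w ^ 2))"
  proof (rule sum.reindex_bij_witness[of _ "\<lambda>w. (1 + w) / (1 - w)" "\<lambda>j. (j - 1) / (j + 1)"])
    fix j :: 'a assume "j \<in> UNIV - {-1}"
    then have j: "j + 1 \<noteq> 0" by (auto simp: add_eq_0_iff2)
    let ?w = "(j - 1) / (j + 1)"
    \<comment> \<open>The inverse substitution is \<open>j = (1 + w) / (1 - w)\<close>; the value \<open>w = 1\<close> would belong to \<open>j = \<infinity>\<close>.\<close>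
    have a: "1 + ?w = 2 * j / (j + 1)" and b: "1 - ?w = 2 / (j + 1)"
      using j by (simp_all add: field_simps)
    show "(1 + ?w) / (1 - ?w) = j" unfolding a b using j two by simp
    have "?w \<noteq> 1" using b j two by auto
    then show "?w \<in> UNIV - {1}" by simp
    have "1 - ?w ^ 2 = (1 + ?w) * (1 - ?w)"
      by (simp add: power2_eq_square algebra_simps)
    also have "\<dots> = (2 / (j + 1)) ^ 2 * j"
      unfolding a b by (simp add: power2_eq_square)
    finally have 1: "\<chi> (1 - ?w ^ 2) = \<chi> j"
      using j two quad_char_mult_square[OF odd, of "2 / (j + 1)" j] by simp
    have 2: "\<chi> (x * (j + 1) ^ 2 + (j - 1) ^ 2) = \<chi> (x + ?w ^ 2)" for x
    proof -
      have "x * (j + 1) ^ 2 + (j - 1) ^ 2 = (j + 1) ^ 2 * (x + ?w ^ 2)"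
        using j by (simp add: distrib_left power_divide mult.commute)
      then show ?thesis using quad_char_mult_square[OF odd j] by simp
    qed
    show "\<chi> (1 - ?w ^ 2) * fibre_sum (?w ^ 2) = G j"
      unfolding 1 fibre_sum_def G_def 2 sum_distrib_left quad_char_mult[OF odd]
      by (simp add: mult.assoc)
  next
    fix w :: 'a assume "w \<in> UNIV - {1}"
    then have w: "1 - w \<noteq> 0" by simp
    let ?j = "(1 + w) / (1 - w)"
    have a: "?j + 1 = 2 / (1 - w)" and b: "?j - 1 = 2 * w / (1 - w)"
      using w by (simp_all add: field_simps)
    show "(?j - 1) / (?j + 1) = w" unfolding a b using w two by simp
    have "?j \<noteq> - 1" using a w two by auto
    then show "?j \<in> UNIV - {-1}" by simp
  qed
  also have "\<dots> = (\<Sum>w\<in>(UNIV::'a set). \<chi> (1 - w ^ 2) * fibre_sum (w ^ 2))"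
    by (rule sum_UNIV_diff_zero) simp
  finally show ?thesis by simp
qed

text \<open>
  Summation over \<open>z\<close> first leaves a quadratic polynomial in \<open>z\<close>, which degenerates only for \<open>x = - 1\<close>; that value
  of \<open>x\<close> produces the term with \<open>\<chi> 2\<close>.
\<close>

lemma sum_fibre_sum:
  assumes q: "CARD('a::{field,finite}) mod 4 = 3"
  shows "(\<Sum>z\<in>(UNIV::'a set). \<chi> (1 - z) * fibre_sum z) = 1 + int CARD('a) * \<chi> (2::'a)"
proof -
  note odd = odd_if_3_mod_4[OF q]
  have inner: "(\<Sum>z\<in>UNIV. \<chi> (1 - z) * \<chi> (x + z)) = 1 - (if x = -1 then int CARD('a) else 0)" for x :: 'a
  proof -
    have "\<chi> (1 - z) = - \<chi> (z + -1)" for z :: 'a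
      using quad_char_minus[OF q, of "z + -1"] by simp
    then have "(\<Sum>z\<in>UNIV. \<chi> (1 - z) * \<chi> (x + z)) = - (\<Sum>z\<in>UNIV. \<chi> (z + -1) * \<chi> (z + x))"
      by (simp add: sum_negf add.commute)
    then show ?thesis
      using sum_quad_char_quadratic[OF odd, of "-1" x] by auto
  qed
  have "(\<Sum>z\<in>(UNIV::'a set). \<chi> (1 - z) * fibre_sum z)
      = (\<Sum>z\<in>(UNIV::'a set). \<Sum>x\<in>UNIV. (\<chi> x * \<chi> (1 - x)) * (\<chi> (1 - z) * \<chi> (x + z)))"
    unfolding fibre_sum_def sum_distrib_left by (simp add: mult_ac)
  also have "\<dots> = (\<Sum>x\<in>UNIV. \<Sum>z\<in>(UNIV::'a set). (\<chi> x * \<chi> (1 - x)) * (\<chi> (1 - z) * \<chi> (x + z)))"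
    by (rule sum.swap)
  also have "\<dots> = (\<Sum>x\<in>(UNIV::'a set). (\<chi> x * \<chi> (1 - x)) * (1 - (if x = -1 then int CARD('a) else 0)))"
    by (simp only: sum_distrib_left[symmetric] inner)
  also have "\<dots> = (\<Sum>x\<in>(UNIV::'a set). \<chi> x * \<chi> (1 - x) - (if x = -1 then - \<chi> (2::'a) * int CARD('a) else 0))"
    by (intro sum.cong) (simp_all add: algebra_simps quad_char_minus_1[OF q])
  also have "\<dots> = 1 + int CARD('a) * \<chi> (2::'a)"
    by (simp add: sum_subtractf sum_quad_char_x_1_minus_x[OF q])
  finally show ?thesis .
qed

text \<open>
  A pair \<open>(x, z)\<close> with sum \<open>u\<close> and product \<open>v\<close> is a choice of a root \<open>x\<close> of \<open>X\<^sup>2 - u X + v\<close>.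
\<close>

lemma sum_symmetric:
  fixes F :: "'a::{field,finite} \<Rightarrow> 'a \<Rightarrow> int"
  assumes odd: "odd CARD('a)"
  shows "(\<Sum>z\<in>UNIV. \<Sum>x\<in>UNIV. F (x + z) (x * z)) = (\<Sum>u\<in>UNIV. \<Sum>v\<in>UNIV. (1 + \<chi> (u ^ 2 - 4 * v)) * F u v)"
proof -
  have "(\<Sum>z\<in>UNIV. \<Sum>x\<in>UNIV. F (x + z) (x * z)) = (\<Sum>x\<in>UNIV. \<Sum>z\<in>UNIV. F (x + z) (x * z))"
    by (rule sum.swap)
  also have "\<dots> = (\<Sum>x\<in>UNIV. \<Sum>u\<in>UNIV. F u (x * (u - x)))"
  proof (rule sum.cong[OF refl])
    fix x :: 'a
    show "(\<Sum>z\<in>UNIV. F (x + z) (x * z)) = (\<Sum>u\<in>UNIV. F u (x * (u - x)))"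
      by (subst sum_affine[of 1 _ "- x"]) simp_all
  qed
  also have "\<dots> = (\<Sum>u\<in>UNIV. \<Sum>x\<in>UNIV. F u (x * (u - x)))"
    by (rule sum.swap)
  also have "\<dots> = (\<Sum>u\<in>UNIV. \<Sum>v\<in>UNIV. (1 + \<chi> (u ^ 2 - 4 * v)) * F u v)"
  proof (rule sum.cong[OF refl])
    fix u :: 'a
    have *: "{x \<in> UNIV. x * (u - x) = v} = {x. x ^ 2 - u * x + v = 0}" for v
    proof (intro Collect_cong)
      fix x
      have "x ^ 2 - u * x + v = v - x * (u - x)" by (simp add: power2_eq_square algebra_simps)
      then show "x \<in> UNIV \<and> x * (u - x) = v \<longleftrightarrow> x ^ 2 - u * x + v = 0" by auto
    qed
    have "(\<Sum>x\<in>UNIV. F u (x * (u - x))) = (\<Sum>v\<in>UNIV. int (card {x \<in> UNIV. x * (u - x) = v}) * F u v)"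
      by (rule sum_fibers) simp
    then show "(\<Sum>x\<in>UNIV. F u (x * (u - x))) = (\<Sum>v\<in>UNIV. (1 + \<chi> (u ^ 2 - 4 * v)) * F u v)"
      by (simp only: * card_quadratic_roots[OF odd])
  qed
  finally show ?thesis .
qed

text \<open>
  As a double sum in \<open>x\<close> and \<open>z\<close> this is symmetric. In the elementary symmetric functions \<open>u\<close> and \<open>v\<close> the summand is
  \<open>\<chi> (u v (1 - u + v))\<close>. Its unweighted sum is \<open>q\<close>. With the weight \<open>\<chi> (u\<^sup>2 - 4 v)\<close> and fixed \<open>u\<close> it is a cubic in \<open>v\<close>, and
  its roots become \<open>0, - (u / 2)\<^sup>2, - (u / 2 - 1)\<^sup>2\<close> after the shift \<open>v = s + (u / 2)\<^sup>2\<close>. So the isogeny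
  applies, and the squares it produces are \<open>1\<close> and \<open>(u - 1)\<^sup>2\<close>.
\<close>

lemma sum_fibre_sum_twisted:
  assumes q: "CARD('a::{field,finite}) mod 4 = 3"
  shows "(\<Sum>z\<in>(UNIV::'a set). \<chi> z * \<chi> (1 - z) * fibre_sum z) = int CARD('a) - legendre_moment TYPE('a)"
proof -
  note odd = odd_if_3_mod_4[OF q]
  note two = two_neq_0_if_odd_card[OF odd]
  define F where "F u v = \<chi> v * \<chi> (1 - u + v) * \<chi> u" for u v :: 'a
  have "(\<Sum>z\<in>(UNIV::'a set). \<chi> z * \<chi> (1 - z) * fibre_sum z) = (\<Sum>z\<in>UNIV. \<Sum>x\<in>UNIV. F (x + z) (x * z))"
    unfolding fibre_sum_def sum_distrib_left
  proof (intro sum.cong refl)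
    fix x z :: 'a
    have "1 - (x + z) + x * z = (1 - x) * (1 - z)" by (simp add: algebra_simps)
    then show "\<chi> z * \<chi> (1 - z) * (\<chi> x * \<chi> (1 - x) * \<chi> (x + z)) = F (x + z) (x * z)"
      by (simp add: F_def quad_char_mult[OF odd])
  qed
  also have "\<dots> = (\<Sum>u\<in>UNIV. \<Sum>v\<in>UNIV. F u v) + (\<Sum>u\<in>UNIV. \<Sum>v\<in>UNIV. \<chi> (u ^ 2 - 4 * v) * F u v)"
    unfolding sum_symmetric[OF odd] by (simp add: distrib_right sum.distrib)
  also have "(\<Sum>u\<in>UNIV. \<Sum>v\<in>UNIV. F u v) = int CARD('a)"
  proof -
    have "(\<Sum>u\<in>UNIV. \<Sum>v\<in>UNIV. F u v) = (\<Sum>v\<in>UNIV. \<Sum>u\<in>UNIV. F u v)"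
      by (rule sum.swap)
    also have "\<dots> = (\<Sum>v\<in>(UNIV::'a set). \<chi> v - (if v = -1 then - int CARD('a) else 0))"
    proof (rule sum.cong[OF refl])
      fix v :: 'a
      \<comment> \<open>The quadratic polynomial \<open>u (1 + v - u)\<close> in \<open>u\<close> degenerates at \<open>v = - 1\<close> only.\<close>
      have m: "\<chi> (1 - u + v) = - \<chi> (u + - (1 + v))" for u
        using quad_char_minus[OF q, of "u + - (1 + v)"] by (simp add: algebra_simps)
      have "(\<Sum>u\<in>UNIV. F u v) = - \<chi> v * (\<Sum>u\<in>UNIV. \<chi> (u + 0) * \<chi> (u + - (1 + v)))"
        unfolding F_def m sum_distrib_left by (simp add: mult_ac)
      also have "\<dots> = - \<chi> v * (if 0 = - (1 + v) then int CARD('a) - 1 else -1)"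
        by (simp only: sum_quad_char_quadratic[OF odd])
      also have "\<dots> = \<chi> v - (if v = -1 then - int CARD('a) else 0)"
      proof (cases "v = -1")
        case False
        then have "0 \<noteq> - (1 + v)" by (metis add_eq_0_iff neg_equal_0_iff_equal)
        then show ?thesis using False by simp
      qed (simp add: quad_char_minus_1[OF q])
      finally show "(\<Sum>u\<in>UNIV. F u v) = \<chi> v - (if v = -1 then - int CARD('a) else 0)" .
    qed
    also have "\<dots> = int CARD('a)"
      by (simp add: sum_subtractf sum_quad_char[OF odd])
    finally show ?thesis .
  qed
  also have "(\<Sum>u\<in>UNIV. \<Sum>v\<in>UNIV. \<chi> (u ^ 2 - 4 * v) * F u v) = (\<Sum>u\<in>(UNIV::'a set). - (\<chi> u * legendre_sum (u - 1)))"
  proof (rule sum.cong[OF refl])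
    fix u :: 'a
    define h where "h = u / 2"
    have u: "u = 2 * h" using two by (simp add: h_def)
    have "(\<Sum>v\<in>UNIV. \<chi> (u ^ 2 - 4 * v) * F u v)
        = (\<Sum>s\<in>UNIV. \<chi> (u ^ 2 - 4 * (1 * s + h ^ 2)) * F u (1 * s + h ^ 2))"
      by (rule sum_affine) simp
    also have "\<dots> = (\<Sum>s\<in>UNIV. - \<chi> u * (\<chi> s * \<chi> (s + h ^ 2) * \<chi> (s + (h - 1) ^ 2)))"
    proof (rule sum.cong[OF refl])
      fix s
      have "u ^ 2 - 4 * (1 * s + h ^ 2) = - (2 ^ 2 * s)"
        by (simp add: u power2_eq_square algebra_simps)
      then have 1: "\<chi> (u ^ 2 - 4 * (1 * s + h ^ 2)) = - \<chi> s"
        by (simp only: quad_char_minus[OF q] quad_char_mult_square[OF odd two])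
      have 2: "1 - u + (1 * s + h ^ 2) = s + (h - 1) ^ 2"
        by (simp add: u power2_eq_square algebra_simps)
      show "\<chi> (u ^ 2 - 4 * (1 * s + h ^ 2)) * F u (1 * s + h ^ 2) = - \<chi> u * (\<chi> s * \<chi> (s + h ^ 2) * \<chi> (s + (h - 1) ^ 2))"
        unfolding 1 F_def 2 by (simp add: mult_ac)
    qed
    also have "\<dots> = - \<chi> u * (\<Sum>s\<in>UNIV. \<chi> s * \<chi> (s - (h - (h - 1)) ^ 2) * \<chi> (s - (h + (h - 1)) ^ 2))"
      by (simp only: sum_distrib_left[symmetric] quad_char_isogeny_split[OF odd])
    also have "\<dots> = - (\<chi> u * legendre_sum (u - 1))"
      by (simp add: legendre_sum_def u algebra_simps)
    finally show "(\<Sum>v\<in>UNIV. \<chi> (u ^ 2 - 4 * v) * F u v) = - (\<chi> u * legendre_sum (u - 1))" .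
  qed
  also have "\<dots> = - legendre_moment TYPE('a)"
    unfolding legendre_moment_def by (subst sum_affine[of 1 _ 1]) (simp_all add: sum_negf)
  finally show ?thesis by simp
qed

lemma double_sum_eq_legendre_moment:
  assumes q: "CARD('a::{field,finite}) mod 4 = 3"
  shows "(\<Sum>j\<in>UNIV - {0::'a}. \<Sum>x\<in>UNIV - {0::'a}.
            \<chi> (j * x) * \<chi> (1 - x) * \<chi> (x * (j + 1) ^ 2 + (j - 1) ^ 2))
       = int CARD('a) * (1 + \<chi> (2::'a)) - legendre_moment TYPE('a)"
proof -
  note odd = odd_if_3_mod_4[OF q]
  have "(\<Sum>w\<in>(UNIV::'a set). \<chi> (1 - w ^ 2) * fibre_sum (w ^ 2))
      = (\<Sum>z\<in>(UNIV::'a set). (1 + \<chi> z) * (\<chi> (1 - z) * fibre_sum z))"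
    by (rule sum_squares[OF odd])
  also have "\<dots> = (\<Sum>z\<in>(UNIV::'a set). \<chi> (1 - z) * fibre_sum z) + (\<Sum>z\<in>(UNIV::'a set). \<chi> z * \<chi> (1 - z) * fibre_sum z)"
    by (simp add: distrib_right sum.distrib mult.assoc)
  finally show ?thesis
    unfolding double_sum_eq_fibre_sums[OF q] sum_fibre_sum[OF q] sum_fibre_sum_twisted[OF q]
    by (simp add: algebra_simps)
qed

section \<open>The quadratic extension by a square root of minus one\<close>

text \<open>
  Over a field with \<open>q \<equiv> 3 (mod 4)\<close> elements this is the field with \<open>q\<^sup>2\<close> elements. It is a commutative ring over
  every commutative ring, and that is all the type classes can record; the absence of zero divisors is
  the lemma \<open>gauss_eq_0_if_mult_eq_0\<close>.
\<close>

datatype 'a gauss = Gauss (re: 'a) (im: 'a)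

lemma gauss_eq_iff: "z = w \<longleftrightarrow> re z = re w \<and> im z = im w"
  by (cases z; cases w) simp

instantiation gauss :: (comm_ring_1) comm_ring_1
begin

definition "0 = Gauss 0 0"
definition "1 = Gauss 1 0"
definition "z + w = Gauss (re z + re w) (im z + im w)"
definition "- z = Gauss (- re z) (- im z)"
definition "z - w = Gauss (re z - re w) (im z - im w)"
definition "z * w = Gauss (re z * re w - im z * im w) (re z * im w + im z * re w)"

instance
  by standard
    (simp_all add: gauss_eq_iff zero_gauss_def one_gauss_def plus_gauss_def uminus_gauss_def
      minus_gauss_def times_gauss_def algebra_simps)

end

lemma gauss_components [simp]:
  "re 0 = 0" "im 0 = 0" "re 1 = 1" "im 1 = 0"
  "re (z + w) = re z + re w" "im (z + w) = im z + im w"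
  "re (- z) = - re z" "im (- z) = - im z"
  "re (z - w) = re z - re w" "im (z - w) = im z - im w"
  "re (z * w) = re z * re w - im z * im w" "im (z * w) = re z * im w + im z * re w"
  by (simp_all add: zero_gauss_def one_gauss_def plus_gauss_def uminus_gauss_def
      minus_gauss_def times_gauss_def)

instance gauss :: (finite) finite
proof
  have "(UNIV :: 'a gauss set) = (\<lambda>(x, y). Gauss x y) ` UNIV"
    by (auto simp: image_iff) (metis gauss.collapse)
  then show "finite (UNIV :: 'a gauss set)" by (metis finite finite_imageI)
qed

definition gconj :: "'a::comm_ring_1 gauss \<Rightarrow> 'a gauss" where
  "gconj z = Gauss (re z) (- im z)"

definition gi :: "'a::comm_ring_1 gauss" where
  "gi = Gauss 0 1"

definition of_base :: "'a::comm_ring_1 \<Rightarrow> 'a gauss" where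
  "of_base x = Gauss x 0"

lemma gauss_conj_components [simp]:
  "re (gconj z) = re z" "im (gconj z) = - im z" "re gi = 0" "im gi = 1"
  "re (of_base x) = x" "im (of_base x) = 0"
  by (simp_all add: gconj_def gi_def of_base_def)

lemma gconj_mult: "gconj (z * w) = gconj z * gconj w"
  by (simp add: gauss_eq_iff)

lemma gconj_power: "gconj (z ^ n) = gconj z ^ n"
  by (induction n) (simp_all add: gconj_mult, simp add: gauss_eq_iff)

lemma gi_square: "gi * gi = -1"
  by (simp add: gauss_eq_iff)

lemma gi_power_4: "gi ^ 4 = 1"
proof -
  have "gi ^ 4 = (gi * gi) * (gi * gi)" by (simp add: power4_eq_xxxx mult.assoc)
  then show ?thesis by (simp add: gi_square)
qed

lemma of_base_mult: "of_base (x * y) = of_base x * of_base y"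
  by (simp add: gauss_eq_iff)

lemma of_base_power: "of_base (x ^ n) = of_base x ^ n"
  by (induction n) (simp_all add: of_base_mult, simp add: gauss_eq_iff)

lemma of_nat_gauss: "of_nat n = of_base (of_nat n)"
  by (induction n) (simp_all add: gauss_eq_iff)

lemma power_cong_mod:
  fixes z :: "'a::monoid_mult"
  assumes "z ^ m = 1" "a mod m = b mod m"
  shows "z ^ a = z ^ b"
proof -
  have "z ^ a = z ^ (a mod m)" for a
    by (subst div_mult_mod_eq[of a m, symmetric], subst power_add, subst mult.commute) (simp add: power_mult assms(1))
  then show ?thesis using assms(2) by metis
qed

text \<open>
  The norm \<open>x\<^sup>2 + y\<^sup>2\<close> is multiplicative, and it vanishes only at \<open>0\<close> because \<open>- 1\<close> is not a square.
\<close>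

lemma gauss_eq_0_if_mult_eq_0:
  fixes z w :: "'a::{field,finite} gauss"
  assumes q: "CARD('a) mod 4 = 3" and "z * w = 0"
  shows "z = 0 \<or> w = 0"
proof -
  have norm0: "u = 0" if "re u ^ 2 + im u ^ 2 = 0" for u :: "'a gauss"
  proof -
    have "im u = 0"
    proof (rule ccontr)
      assume im: "im u \<noteq> 0"
      then have "(re u / im u) ^ 2 = -1"
        using that by (simp add: field_simps eq_neg_iff_add_eq_0)
      then have "\<chi> (-1 :: 'a) \<in> {0, 1}"
        by (metis quad_char_square insertCI)
      then show False using quad_char_minus_1[OF q] by simp
    qed
    then show ?thesis using that by (simp add: gauss_eq_iff)
  qed
  have "(re z ^ 2 + im z ^ 2) * (re w ^ 2 + im w ^ 2) = re (z * w) ^ 2 + im (z * w) ^ 2"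
    by (simp add: power2_eq_square algebra_simps)
  also have "\<dots> = 0" by (simp add: assms(2))
  finally show ?thesis using norm0 by auto
qed

lemma CHAR_eq_if_card_prime_power:
  assumes "prime p" "CARD('a::{field,finite}) = p ^ n"
  shows "CHAR('a) = p"
proof -
  have "prime CHAR('a)"
    by (rule prime_CHAR_semidom) (simp add: finite_imp_CHAR_pos)
  moreover have "CHAR('a) dvd p ^ n"
    using CHAR_dvd_CARD[where 'a = 'a] assms(2) by simp
  ultimately show ?thesis
    using assms(1) by (metis prime_dvd_power primes_dvd_imp_eq)
qed

lemma CHAR_gauss: "CHAR('a::{field,finite} gauss) = CHAR('a)"
proof (rule CHAR_eqI)
  show "of_nat CHAR('a) = (0 :: 'a gauss)"
    by (simp add: of_nat_gauss gauss_eq_iff)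
next
  fix x assume "of_nat x = (0 :: 'a gauss)"
  then have "of_nat x = (0 :: 'a)"
    by (simp add: of_nat_gauss gauss_eq_iff)
  then show "CHAR('a) dvd x"
    by (simp add: of_nat_eq_0_iff_char_dvd)
qed

text \<open>
  The \<open>q\<close>-th power is additive and fixes the ground field, and \<open>i ^ q = i\<^sup>3 = - i\<close>.
\<close>

lemma gauss_frobenius:
  fixes z :: "'a::{field,finite} gauss"
  assumes "prime p" "CARD('a) = p ^ n" and q: "CARD('a) mod 4 = 3"
  shows "z ^ CARD('a) = gconj z"
proof -
  have char: "CHAR('a gauss) = p"
    using CHAR_eq_if_card_prime_power[OF assms(1,2)] by (simp add: CHAR_gauss)
  have base: "of_base x ^ CARD('a) = of_base x" for x :: 'a
  proof -
    have "x ^ CARD('a) = x"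
    proof (cases "x = 0")
      case False
      have "x ^ CARD('a) = x * x ^ (CARD('a) - 1)"
        by (metis power_eq_if zero_less_card_finite less_irrefl)
      then show ?thesis using finite_field_power_card_minus_1[OF False] by simp
    qed simp
    then show ?thesis by (simp flip: of_base_power)
  qed
  have "(gi :: 'a gauss) ^ CARD('a) = gi ^ 3"
    by (rule power_cong_mod[OF gi_power_4]) (simp add: q)
  also have "\<dots> = - gi"
    by (simp add: power3_eq_cube gi_square)
  finally have gi: "(gi :: 'a gauss) ^ CARD('a) = - gi" .
  have z: "z = of_base (re z) + gi * of_base (im z)"
    by (simp add: gauss_eq_iff)
  have "(of_base (re z) + gi * of_base (im z)) ^ CARD('a)
      = of_base (re z) ^ CARD('a) + (gi * of_base (im z)) ^ CARD('a)"
    by (rule freshmans_dream') (use assms(1,2) char in auto)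
  also have "\<dots> = gconj z"
    by (simp add: power_mult_distrib base gi) (simp add: gauss_eq_iff)
  finally show ?thesis by (simp flip: z)
qed

text \<open>
  Compare two values of \<open>(1 + i) ^ q\<close>: it is \<open>1 - i\<close> by Frobenius, and it is \<open>(1 + i) (2 i) ^ m\<close> for
  \<open>q = 2 m + 1\<close> because \<open>(1 + i)\<^sup>2 = 2 i\<close>. Here \<open>2 ^ m = \<chi> 2\<close>, and \<open>i ^ m\<close> depends on \<open>q\<close> modulo \<open>8\<close>.
\<close>

lemma quad_char_2:
  assumes "prime p" "CARD('a::{field,finite}) = p ^ n" and q: "CARD('a) mod 4 = 3"
  shows "\<chi> (2 :: 'a) = (if CARD('a) mod 8 = 7 then 1 else -1)"
proof -
  note odd = odd_if_3_mod_4[OF q]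
  define m where "m = (CARD('a) - 1) div 2"
  have card: "CARD('a) = 2 * m + 1" using odd unfolding m_def by presburger
  have "gconj (1 + gi :: 'a gauss) = (1 + gi :: 'a gauss) ^ CARD('a)"
    by (rule gauss_frobenius[OF assms, symmetric])
  also have "\<dots> = (1 + gi) * ((1 + gi) ^ 2) ^ m"
    by (simp only: card power_Suc power_mult Suc_eq_plus1[symmetric])
  finally have pow: "gconj (1 + gi :: 'a gauss) = (1 + gi) * ((1 + gi) ^ 2) ^ m" .
  have sq: "(1 + gi :: 'a gauss) ^ 2 = of_base 2 * gi"
    by (simp add: gauss_eq_iff power2_eq_square)
  have two_m: "(2::'a) ^ m = of_int (\<chi> (2::'a))"
    unfolding m_def by (rule euler_criterion[OF odd, symmetric])
  \<comment> \<open>The real part of this equation determines \<open>\<chi> 2\<close> once \<open>i ^ m\<close> is known.\<close>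
  have eq: "gconj (1 + gi :: 'a gauss) = (1 + gi) * (of_base (of_int (\<chi> (2::'a))) * gi ^ m)"
    unfolding pow sq by (simp only: power_mult_distrib of_base_power[symmetric] two_m)
  show ?thesis
  proof (cases "CARD('a) mod 8 = 7")
    case True
    then have "CARD('a) = 8 * (CARD('a) div 8) + 7"
      using mult_div_mod_eq[of 8 "CARD('a)"] by simp
    then have "m = 4 * (CARD('a) div 8) + 3" using card by linarith
    then have "m mod 4 = 3 mod 4" by simp
    then have "(gi :: 'a gauss) ^ m = gi ^ 3"
      by (rule power_cong_mod[OF gi_power_4])
    then have "(gi :: 'a gauss) ^ m = - gi"
      by (simp add: power3_eq_cube gi_square)
    then have "of_int (\<chi> (2::'a)) = (of_int 1 :: 'a)"
      using arg_cong[OF eq, of re] by simp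
    then have "\<chi> (2::'a) = 1" by (intro quad_char_eqI[OF odd]) simp_all
    then show ?thesis using True by simp
  next
    case False
    then have "CARD('a) mod 8 = 3" using q by presburger
    then have "CARD('a) = 8 * (CARD('a) div 8) + 3"
      using mult_div_mod_eq[of 8 "CARD('a)"] by simp
    then have "m = 4 * (CARD('a) div 8) + 1" using card by linarith
    then have "m mod 4 = 1 mod 4" by simp
    then have "(gi :: 'a gauss) ^ m = gi ^ 1"
      by (rule power_cong_mod[OF gi_power_4])
    then have "1 = - (of_int (\<chi> (2::'a)) :: 'a)"
      using arg_cong[OF eq, of re] by simp
    then have "of_int (\<chi> (2::'a)) = (of_int (-1) :: 'a)"
      by (metis minus_minus of_int_1 of_int_minus)
    then have "\<chi> (2::'a) = -1" by (intro quad_char_eqI[OF odd]) simp_all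
    then show ?thesis using False by simp
  qed
qed

section \<open>The unit circle\<close>

definition unit_circle :: "'a::comm_ring_1 gauss set" where
  "unit_circle = {z. z * gconj z = 1}"

lemma unit_circle_iff: "z \<in> unit_circle \<longleftrightarrow> re z ^ 2 + im z ^ 2 = 1"
  by (auto simp: unit_circle_def gauss_eq_iff power2_eq_square algebra_simps)

lemma unit_circle_mult:
  "z \<in> unit_circle \<Longrightarrow> w \<in> unit_circle \<Longrightarrow> z * w \<in> unit_circle"
proof -
  have "z * w * gconj (z * w) = (z * gconj z) * (w * gconj w)"
    by (simp add: gconj_mult mult_ac)
  then show "z \<in> unit_circle \<Longrightarrow> w \<in> unit_circle \<Longrightarrow> z * w \<in> unit_circle"
    by (simp add: unit_circle_def)
qed

lemma unit_circle_power: "z \<in> unit_circle \<Longrightarrow> z ^ n \<in> unit_circle"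
  by (induction n) (simp_all add: unit_circle_mult, simp add: unit_circle_iff)

lemma gconj_gconj [simp]: "gconj (gconj z) = z"
  by (simp add: gauss_eq_iff)

lemma unit_circle_gconj: "z \<in> unit_circle \<Longrightarrow> gconj z \<in> unit_circle"
  by (simp add: unit_circle_def mult.commute)

text \<open>
  A point of the circle above \<open>x\<close> is a square root of \<open>1 - x\<^sup>2\<close>, and \<open>\<chi> (1 - x\<^sup>2) = - \<chi> (x\<^sup>2 - 1)\<close>.
\<close>

lemma sum_unit_circle:
  fixes f :: "'a::{field,finite} \<Rightarrow> int"
  assumes q: "CARD('a) mod 4 = 3"
  shows "(\<Sum>z\<in>unit_circle. f (re z)) = (\<Sum>x\<in>UNIV. (1 - \<chi> (x ^ 2 - 1)) * f x)"
proof -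
  have "(\<Sum>z\<in>unit_circle. f (re z)) = (\<Sum>x\<in>UNIV. int (card {z \<in> unit_circle. re z = x}) * f x)"
    by (rule sum_fibers) simp
  also have "\<dots> = (\<Sum>x\<in>UNIV. (1 - \<chi> (x ^ 2 - 1)) * f x)"
  proof (rule sum.cong[OF refl])
    fix x :: 'a
    have "bij_betw im {z \<in> unit_circle. re z = x} {y. y ^ 2 = 1 - x ^ 2}"
      by (rule bij_betw_byWitness[where f' = "Gauss x"])
         (auto simp: unit_circle_iff gauss_eq_iff eq_diff_eq add.commute)
    then have "card {z \<in> unit_circle. re z = x} = card {y. y ^ 2 = 1 - x ^ 2}"
      by (rule bij_betw_same_card)
    moreover have "\<chi> (1 - x ^ 2) = - \<chi> (x ^ 2 - 1)"
      using quad_char_minus[OF q, of "x ^ 2 - 1"] by simp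
    ultimately show "int (card {z \<in> unit_circle. re z = x}) * f x = (1 - \<chi> (x ^ 2 - 1)) * f x"
      by (simp add: card_square_roots[OF odd_if_3_mod_4[OF q]])
  qed
  finally show ?thesis .
qed

section \<open>The odd part of the unit circle\<close>

text \<open>
  The circle has \<open>q + 1\<close> elements. If \<open>q \<equiv> 3 (mod 8)\<close>, then \<open>(q + 1) / 4\<close> is odd, and this is the
  subgroup of elements of odd order.
\<close>

definition odd_part :: "'a::{field,finite} gauss set" where
  "odd_part = {v \<in> unit_circle. v ^ ((CARD('a) + 1) div 4) = 1}"

lemma unit_circle_power_card:
  fixes z :: "'a::{field,finite} gauss"
  assumes "prime p" "CARD('a) = p ^ n" "CARD('a) mod 4 = 3" "z \<in> unit_circle"
  shows "z ^ (CARD('a) + 1) = 1"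
  using gauss_frobenius[OF assms(1-3), of z] assms(4) by (simp add: unit_circle_def)

lemma odd_part_mult: "v \<in> odd_part \<Longrightarrow> w \<in> odd_part \<Longrightarrow> v * w \<in> odd_part"
  by (simp add: odd_part_def unit_circle_mult power_mult_distrib)

lemma odd_part_gconj: "v \<in> odd_part \<Longrightarrow> gconj v \<in> odd_part"
  by (simp add: odd_part_def unit_circle_gconj flip: gconj_power) (simp add: gauss_eq_iff)

lemma odd_part_unit: "v \<in> odd_part \<Longrightarrow> v * gconj v = 1"
  by (simp add: odd_part_def unit_circle_def)

lemma fourth_root_of_unity:
  fixes z :: "'a::{field,finite} gauss"
  assumes q: "CARD('a) mod 4 = 3" and "z ^ 4 = 1"
  shows "z \<in> {1, -1, gi, -gi}"
proof -
  have "(z - 1) * ((z + 1) * ((z - gi) * (z + gi))) = z ^ 4 - 1 + (z * z - 1) * (- (gi * gi) - 1)"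
    by (simp add: algebra_simps power4_eq_xxxx)
  also have "\<dots> = 0" by (simp add: assms(2) gi_square)
  finally have "z - 1 = 0 \<or> z + 1 = 0 \<or> z - gi = 0 \<or> z + gi = 0"
    using gauss_eq_0_if_mult_eq_0[OF q] by blast
  then show ?thesis by (auto simp: eq_neg_iff_add_eq_0)
qed

text \<open>
  With \<open>N = (q + 1) / 4\<close> odd, \<open>N\<^sup>2 \<equiv> 1 (mod 4)\<close>. Hence \<open>z \<mapsto> z ^ N\<^sup>2\<close> is the identity on the fourth roots of
  unity and trivial on the odd part: it is the projection onto the first factor.
\<close>

lemma unit_circle_decomposition:
  assumes "prime p" "CARD('a::{field,finite}) = p ^ n" and q: "CARD('a) mod 8 = 3"
  shows "bij_betw (\<lambda>(i, v). i * v) ({1, -1, gi, -gi} \<times> odd_part) (unit_circle :: 'a gauss set)"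
proof -
  define N where "N = (CARD('a) + 1) div 4"
  have N: "CARD('a) + 1 = 4 * N" and oddN: "odd N"
    using q unfolding N_def by presburger+
  have q4: "CARD('a) mod 4 = 3" using q by presburger
  have N2: "(N * N) mod 4 = 1"
  proof -
    obtain k where "N = 2 * k + 1" using oddN by (elim oddE)
    then have "N * N = 1 + 4 * (k * k + k)" by (simp add: algebra_simps)
    then show ?thesis by simp
  qed
  \<comment> \<open>\<open>N\<^sup>3 - N\<close> is a multiple of \<open>4 N\<close>; this puts the complementary factor \<open>z / z ^ N\<^sup>2\<close> into the odd part.\<close>
  have cube: "z ^ (N * (N * N)) = z ^ N" if "z \<in> unit_circle" for z :: "'a gauss"
  proof (rule power_cong_mod[where m = "4 * N"])
    show "z ^ (4 * N) = 1"
      using unit_circle_power_card[OF assms(1,2) q4 that] unfolding N .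
    obtain k where "N * N = 4 * k + 1" using N2 by (metis mult_div_mod_eq)
    then have "N * (N * N) = N + 4 * N * k" by (simp add: algebra_simps)
    then show "N * (N * N) mod (4 * N) = N mod (4 * N)" by simp
  qed
  have root_unit: "i \<in> unit_circle" if "i \<in> {1, -1, gi, -gi}" for i :: "'a gauss"
    using that by (auto simp: unit_circle_iff)
  have root4: "i ^ 4 = 1" if "i \<in> {1, -1, gi, -gi}" for i :: "'a gauss"
    using that gi_power_4 by auto
  have odd_part: "v \<in> odd_part \<longleftrightarrow> v \<in> unit_circle \<and> v ^ N = 1" for v :: "'a gauss"
    by (simp add: odd_part_def N_def)
  have recover: "(i * v) ^ (N * N) = i" if "i \<in> {1, -1, gi, -gi}" "v \<in> odd_part" for i v :: "'a gauss"
  proof -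
    have "v ^ (N * N) = 1" using that(2) by (simp add: odd_part power_mult)
    moreover have "i ^ (N * N) = i ^ 1"
      by (rule power_cong_mod[OF root4[OF that(1)]]) (simp add: N2)
    ultimately show ?thesis by (simp add: power_mult_distrib)
  qed
  let ?g = "\<lambda>z :: 'a gauss. (z ^ (N * N), z * gconj (z ^ (N * N)))"
  show ?thesis
  proof (rule bij_betw_byWitness[where f' = ?g])
    show "\<forall>a\<in>{1, -1, gi, -gi} \<times> odd_part. ?g ((\<lambda>(i, v). i * v) a) = (a :: 'a gauss \<times> 'a gauss)"
    proof (rule ballI)
      fix a :: "'a gauss \<times> 'a gauss" assume "a \<in> {1, -1, gi, -gi} \<times> odd_part"
      then obtain i v where a: "a = (i, v)" and iv: "i \<in> {1, -1, gi, -gi}" "v \<in> odd_part"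
        by (metis SigmaE)
      have "i * v * gconj i = v * (i * gconj i)" by (simp add: mult_ac)
      also have "i * gconj i = 1"
        using root_unit[OF iv(1)] by (simp add: unit_circle_def)
      finally show "?g ((\<lambda>(i, v). i * v) a) = a"
        by (simp add: a recover[OF iv])
    qed
    show "\<forall>z\<in>unit_circle. (\<lambda>(i, v). i * v) (?g z) = z"
    proof
      fix z :: "'a gauss" assume "z \<in> unit_circle"
      then have "z ^ (N * N) * gconj (z ^ (N * N)) = 1"
        using unit_circle_power unfolding unit_circle_def by blast
      then have "z * (z ^ (N * N) * gconj (z ^ (N * N))) = z" by simp
      then show "(\<lambda>(i, v). i * v) (?g z) = z"
        by (simp only: prod.case mult.left_commute)
    qed
    show "(\<lambda>(i, v). i * v) ` ({1, -1, gi, -gi} \<times> odd_part) \<subseteq> (unit_circle :: 'a gauss set)"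
    proof (rule image_subsetI)
      fix a :: "'a gauss \<times> 'a gauss" assume "a \<in> {1, -1, gi, -gi} \<times> odd_part"
      then obtain i v where "a = (i, v)" "i \<in> {1, -1, gi, -gi}" "v \<in> odd_part"
        by (metis SigmaE)
      then show "(case a of (i, v) \<Rightarrow> i * v) \<in> unit_circle"
        using root_unit[of i] odd_part[of v] unit_circle_mult[of i v] by simp
    qed
    show "?g ` unit_circle \<subseteq> {1, -1, gi, -gi} \<times> odd_part"
    proof (rule image_subsetI)
      fix z :: "'a gauss" assume z: "z \<in> unit_circle"
      have "N * N * 4 = 4 * N * N" by simp
      then have "(z ^ (N * N)) ^ 4 = (z ^ (4 * N)) ^ N"
        by (metis power_mult)
      also have "\<dots> = 1"
        using unit_circle_power_card[OF assms(1,2) q4 z] unfolding N by simp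
      finally have "z ^ (N * N) \<in> {1, -1, gi, -gi}" by (rule fourth_root_of_unity[OF q4])
      moreover have "z * gconj (z ^ (N * N)) \<in> odd_part"
      proof -
        have "(z * gconj (z ^ (N * N))) ^ N = z ^ N * gconj (z ^ (N * (N * N)))"
          by (simp only: power_mult_distrib gconj_power power_mult)
        also have "\<dots> = 1"
          using unit_circle_power[OF z, of N] unfolding cube[OF z] unit_circle_def by simp
        finally show ?thesis
          using z by (simp add: odd_part unit_circle_mult unit_circle_gconj unit_circle_power)
      qed
      ultimately show "?g z \<in> {1, -1, gi, -gi} \<times> odd_part" by blast
    qed
  qed
qed

lemma sum_unit_circle_decomposition:
  fixes f :: "'a::{field,finite} gauss \<Rightarrow> int"
  assumes "prime p" "CARD('a) = p ^ n" and q: "CARD('a) mod 8 = 3"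
  shows "(\<Sum>z\<in>unit_circle. f z) = (\<Sum>v\<in>odd_part. f v + f (- v) + f (gi * v) + f (- gi * v))"
proof -
  have two: "(2::'a) \<noteq> 0"
    by (rule two_neq_0_if_odd_card) (use q in presburger)
  then have ne: "(1::'a) \<noteq> -1" by (metis add.right_inverse one_add_one)
  have "(\<Sum>z\<in>unit_circle. f z) = (\<Sum>(i, v)\<in>{1, -1, gi, -gi} \<times> odd_part. f (i * v))"
    using sum.reindex_bij_betw[OF unit_circle_decomposition[OF assms], of f]
    by (simp add: case_prod_beta')
  also have "\<dots> = (\<Sum>i\<in>{1, -1, gi, -gi}. \<Sum>v\<in>odd_part. f (i * v))"
    by (simp add: sum.cartesian_product)
  also have "\<dots> = (\<Sum>v\<in>odd_part. f v + f (- v) + f (gi * v) + f (- gi * v))"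
    using ne ne[symmetric] by (simp add: gauss_eq_iff sum.distrib)
  finally show ?thesis .
qed

lemma sum_odd_part_mult:
  fixes w :: "'a::{field,finite} gauss"
  assumes "w \<in> odd_part"
  shows "(\<Sum>v\<in>odd_part. f (w * v)) = (\<Sum>v\<in>odd_part. f v)"
proof (rule sum.reindex_bij_witness[of _ "\<lambda>v. gconj w * v" "\<lambda>v. w * v"])
  fix v :: "'a gauss" assume "v \<in> odd_part"
  then show "w * v \<in> odd_part" "gconj w * v \<in> odd_part"
    using assms odd_part_mult odd_part_gconj by blast+
  have "gconj w * (w * v) = (w * gconj w) * v" "w * (gconj w * v) = (w * gconj w) * v"
    by (simp_all add: mult_ac)
  then show "gconj w * (w * v) = v" "w * (gconj w * v) = v"
    by (simp_all only: odd_part_unit[OF assms] mult_1)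
qed auto

lemma sum_odd_part_gconj: "(\<Sum>v\<in>odd_part. f (gconj v)) = (\<Sum>v\<in>odd_part. f v)"
  by (rule sum.reindex_bij_witness[of _ gconj gconj]) (auto simp: odd_part_gconj)

text \<open>
  If \<open>v\<^sup>2 = w\<^sup>2\<close> but \<open>v = - w\<close>, then raising to the odd power \<open>N\<close> gives \<open>1 = - 1\<close>.
\<close>

lemma bij_betw_odd_part_square:
  assumes q: "CARD('a::{field,finite}) mod 8 = 3"
  shows "bij_betw (\<lambda>v. v ^ 2) odd_part (odd_part :: 'a gauss set)"
proof -
  define N where "N = (CARD('a) + 1) div 4"
  have oddN: "odd N" using q unfolding N_def by presburger
  have q4: "CARD('a) mod 4 = 3" using q by presburger
  have two: "(2::'a) \<noteq> 0"
    by (rule two_neq_0_if_odd_card) (use q in presburger)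
  then have ne: "(1::'a) \<noteq> -1" by (metis add.right_inverse one_add_one)
  have inj: "inj_on (\<lambda>v. v ^ 2) (odd_part :: 'a gauss set)"
  proof (rule inj_onI)
    fix v w :: "'a gauss" assume v: "v \<in> odd_part" and w: "w \<in> odd_part" and eq: "v ^ 2 = w ^ 2"
    have "(v - w) * (v + w) = 0" using eq by (simp add: power2_eq_square algebra_simps)
    then consider "v = w" | "v = - w"
      using gauss_eq_0_if_mult_eq_0[OF q4, of "v - w" "v + w"] by (auto simp: eq_neg_iff_add_eq_0)
    then show "v = w"
    proof cases
      case 2
      then have "v ^ N = - (w ^ N)" using oddN by simp
      then have "(1 :: 'a gauss) = -1" using v w by (simp add: odd_part_def N_def)
      then show ?thesis using ne by (simp add: gauss_eq_iff)
    qed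
  qed
  moreover have "(\<lambda>v. v ^ 2) ` odd_part \<subseteq> (odd_part :: 'a gauss set)"
    by (auto simp: power2_eq_square odd_part_mult)
  ultimately show ?thesis
    by (intro bij_betw_imageI endo_inj_surj) auto
qed

lemma sum_odd_part_square:
  assumes "CARD('a::{field,finite}) mod 8 = 3"
  shows "(\<Sum>v\<in>odd_part. f (v ^ 2 :: 'a gauss)) = (\<Sum>v\<in>odd_part. f v)"
  by (rule sum.reindex_bij_betw[OF bij_betw_odd_part_square[OF assms]])

text \<open>
  Squaring is a bijection of the odd part, so \<open>(a, b) \<mapsto> (a b, a / b)\<close> is a bijection of its pairs. This is what
  allows the product formula for cosines to separate the variables in double sums.
\<close>

lemma sum_odd_part_product:
  fixes F :: "'a::{field,finite} gauss \<Rightarrow> 'a gauss \<Rightarrow> int"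
  assumes q: "CARD('a) mod 8 = 3"
  shows "(\<Sum>a\<in>odd_part. \<Sum>b\<in>odd_part. F (a * b) (a * gconj b)) = (\<Sum>a\<in>odd_part. \<Sum>b\<in>odd_part. F a b)"
proof -
  have "(\<Sum>a\<in>odd_part. \<Sum>b\<in>odd_part. F (a * b) (a * gconj b))
      = (\<Sum>b\<in>odd_part. \<Sum>a\<in>odd_part. F (a * b) (a * gconj b))"
    by (rule sum.swap)
  also have "\<dots> = (\<Sum>b\<in>odd_part. \<Sum>c\<in>odd_part. F c (c * gconj b ^ 2))"
  proof (rule sum.cong[OF refl])
    fix b :: "'a gauss" assume b: "b \<in> odd_part"
    have "(\<Sum>c\<in>odd_part. F c (c * gconj b ^ 2)) = (\<Sum>a\<in>odd_part. F (b * a) ((b * a) * gconj b ^ 2))"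
      by (rule sum_odd_part_mult[OF b, symmetric])
    also have "\<dots> = (\<Sum>a\<in>odd_part. F (a * b) (a * gconj b))"
    proof (rule sum.cong[OF refl])
      fix a
      have "(b * a) * gconj b ^ 2 = (b * gconj b) * (a * gconj b)"
        by (simp add: power2_eq_square mult_ac)
      then show "F (b * a) ((b * a) * gconj b ^ 2) = F (a * b) (a * gconj b)"
        using odd_part_unit[OF b] by (simp add: mult.commute)
    qed
    finally show "(\<Sum>a\<in>odd_part. F (a * b) (a * gconj b)) = (\<Sum>c\<in>odd_part. F c (c * gconj b ^ 2))" by simp
  qed
  also have "\<dots> = (\<Sum>c\<in>odd_part. \<Sum>b\<in>odd_part. F c (c * gconj b ^ 2))"
    by (rule sum.swap)
  also have "\<dots> = (\<Sum>c\<in>odd_part. \<Sum>d\<in>odd_part. F c d)"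
  proof (rule sum.cong[OF refl])
    fix c :: "'a gauss" assume c: "c \<in> odd_part"
    have "(\<Sum>b\<in>odd_part. F c (c * gconj b ^ 2)) = (\<Sum>b\<in>odd_part. F c (c * b ^ 2))"
      by (rule sum_odd_part_gconj)
    also have "\<dots> = (\<Sum>b\<in>odd_part. F c (c * b))"
      by (rule sum_odd_part_square[OF q])
    also have "\<dots> = (\<Sum>b\<in>odd_part. F c b)"
      by (rule sum_odd_part_mult[OF c])
    finally show "(\<Sum>b\<in>odd_part. F c (c * gconj b ^ 2)) = (\<Sum>d\<in>odd_part. F c d)" .
  qed
  finally show ?thesis .
qed

section \<open>Cosine sums\<close>

text \<open>
  For \<open>w = 1\<close> and for a primitive eighth root of unity \<open>w\<close> these are the two integers
  \<open>A\<close> and \<open>B\<close> with \<open>A\<^sup>2 + 2 B\<^sup>2 = q\<close>. They are coordinates of an Eisenstein sum of an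
  octic character.
\<close>

definition cos_sum :: "'a::{field,finite} gauss \<Rightarrow> int" where
  "cos_sum w = (\<Sum>v\<in>odd_part. \<chi> (re (w * v)))"

definition cos_pair_sum :: "'a::{field,finite} gauss \<Rightarrow> int" where
  "cos_pair_sum w = (\<Sum>a\<in>odd_part. \<Sum>b\<in>odd_part. \<chi> (re a + re (w * b)))"

text \<open>
  The product formula \<open>2 cos \<alpha> cos \<beta> = cos (\<alpha> + \<beta>) + cos (\<alpha> - \<beta>)\<close>.
\<close>

lemma quad_char_re_mult:
  fixes z w :: "'a::{field,finite} gauss"
  assumes "odd CARD('a)" and two: "\<chi> (2::'a) = -1"
  shows "\<chi> (re z) * \<chi> (re w) = - \<chi> (re (z * w) + re (z * gconj w))"
proof -
  have "re (z * w) + re (z * gconj w) = 2 * (re z * re w)"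
    by (simp add: algebra_simps)
  then show ?thesis
    by (simp only: quad_char_mult[OF assms(1)] two)
qed

lemma cos_sum_1_square:
  assumes q: "CARD('a::{field,finite}) mod 8 = 3" and two: "\<chi> (2::'a) = -1"
  shows "cos_sum (1::'a gauss) ^ 2 = - cos_pair_sum (1::'a gauss)"
proof -
  have odd: "odd CARD('a)" using q by presburger
  have "cos_sum (1::'a gauss) ^ 2 = (\<Sum>a\<in>(odd_part :: 'a gauss set). \<Sum>b\<in>odd_part. \<chi> (re a) * \<chi> (re (b :: 'a gauss)))"
    by (simp add: power2_eq_square cos_sum_def sum_product)
  also have "\<dots> = - (\<Sum>a\<in>(odd_part :: 'a gauss set). \<Sum>b\<in>odd_part. \<chi> (re (a * b) + re (a * gconj b :: 'a gauss)))"
    by (simp only: quad_char_re_mult[OF odd two] sum_negf)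
  also have "\<dots> = - (\<Sum>a\<in>(odd_part :: 'a gauss set). \<Sum>b\<in>odd_part. \<chi> (re a + re (b :: 'a gauss)))"
    by (simp only: sum_odd_part_product[OF q, of "\<lambda>a b. \<chi> (re a + re b)"])
  finally show ?thesis by (simp add: cos_pair_sum_def)
qed

lemma cos_pair_sum_minus_1:
  assumes q: "CARD('a::{field,finite}) mod 4 = 3"
  shows "cos_pair_sum (-1 :: 'a gauss) = 0"
proof -
  have "cos_pair_sum (-1 :: 'a gauss) = (\<Sum>a\<in>(odd_part :: 'a gauss set). \<Sum>b\<in>odd_part. \<chi> (re b + re (-1 * a :: 'a gauss)))"
    unfolding cos_pair_sum_def by (rule sum.swap)
  also have "\<dots> = (\<Sum>a\<in>(odd_part :: 'a gauss set). \<Sum>b\<in>odd_part. - \<chi> (re a + re (-1 * b :: 'a gauss)))"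
  proof (intro sum.cong refl)
    fix a b :: "'a gauss"
    show "\<chi> (re b + re (-1 * a)) = - \<chi> (re a + re (-1 * b))"
      using quad_char_minus[OF q, of "re a - re b"] by simp
  qed
  also have "\<dots> = - cos_pair_sum (-1 :: 'a gauss)"
    by (simp add: cos_pair_sum_def sum_negf)
  finally show ?thesis by simp
qed

lemma cos_pair_sum_minus_gi: "cos_pair_sum (- gi :: 'a::{field,finite} gauss) = cos_pair_sum (gi :: 'a gauss)"
  unfolding cos_pair_sum_def
proof (rule sum.cong[OF refl])
  fix a :: "'a gauss"
  have "(\<Sum>b\<in>odd_part. \<chi> (re a + re (gi * b))) = (\<Sum>b\<in>odd_part. \<chi> (re a + re (gi * gconj b)))"
    by (rule sum_odd_part_gconj[symmetric])
  then show "(\<Sum>b\<in>odd_part. \<chi> (re a + re (- gi * b))) = (\<Sum>b\<in>odd_part. \<chi> (re a + re (gi * b)))"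
    by simp
qed

text \<open>
  The product formula for \<open>\<zeta> a\<close> and \<open>\<zeta> b\<close>: their product is \<open>i a b\<close>, and since \<open>\<zeta>\<close> has norm \<open>- 1\<close>, the
  product of \<open>\<zeta> a\<close> with the conjugate of \<open>\<zeta> b\<close> is \<open>- a / b\<close>.
\<close>

lemma cos_sum_zeta_square:
  fixes z :: "'a::{field,finite} gauss"
  assumes q: "CARD('a) mod 8 = 3" and two: "\<chi> (2::'a) = -1"
    and z: "z * z = gi" "z * gconj z = -1"
  shows "cos_sum z ^ 2 = cos_pair_sum (gi :: 'a gauss)"
proof -
  have odd: "odd CARD('a)" and q4: "CARD('a) mod 4 = 3" using q by presburger+
  have "cos_sum z ^ 2 = (\<Sum>a\<in>(odd_part :: 'a gauss set). \<Sum>b\<in>odd_part. \<chi> (re (z * a)) * \<chi> (re (z * b)))"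
    by (simp only: power2_eq_square cos_sum_def sum_product)
  also have "\<dots> = (\<Sum>a\<in>(odd_part :: 'a gauss set). \<Sum>b\<in>odd_part. \<chi> (re (a * gconj b) + re (- gi * (a * b))))"
  proof (intro sum.cong refl)
    fix a b :: "'a gauss"
    have "(z * a) * (z * b) = gi * (a * b)"
      by (simp add: z(1)[symmetric] mult_ac)
    moreover have "(z * a) * gconj (z * b) = - (a * gconj b)"
    proof -
      have "(z * a) * gconj (z * b) = (z * gconj z) * (a * gconj b)"
        by (simp only: gconj_mult mult_ac)
      then show ?thesis by (simp add: z(2))
    qed
    ultimately have "\<chi> (re (z * a)) * \<chi> (re (z * b)) = - \<chi> (re (gi * (a * b)) + re (- (a * gconj b)))"
      using quad_char_re_mult[OF odd two, of "z * a" "z * b"] by simp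
    also have "re (gi * (a * b)) + re (- (a * gconj b)) = - (re (a * gconj b) + re (- gi * (a * b)))"
      by (simp add: algebra_simps)
    finally show "\<chi> (re (z * a)) * \<chi> (re (z * b)) = \<chi> (re (a * gconj b) + re (- gi * (a * b)))"
      by (simp only: quad_char_minus[OF q4] minus_minus)
  qed
  also have "\<dots> = (\<Sum>a\<in>(odd_part :: 'a gauss set). \<Sum>b\<in>odd_part. \<chi> (re b + re (- gi * a :: 'a gauss)))"
    by (rule sum_odd_part_product[OF q, of "\<lambda>a b. \<chi> (re b + re (- gi * a))"])
  also have "\<dots> = cos_pair_sum (- gi :: 'a gauss)"
    unfolding cos_pair_sum_def by (rule sum.swap)
  finally show ?thesis by (simp only: cos_pair_sum_minus_gi)
qed

text \<open>
  Since \<open>\<chi> (- 2) = 1\<close>, there is \<open>r\<close> with \<open>r\<^sup>2 = - 2\<close>, and \<open>(1 - i) / r\<close> is a square root of \<open>i\<close>. Its norm is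
  \<open>2 / r\<^sup>2 = - 1\<close>, so it does not lie on the circle.
\<close>

lemma eighth_root_exists:
  assumes q: "CARD('a::{field,finite}) mod 4 = 3" and two: "\<chi> (2::'a) = -1"
  obtains z :: "'a::{field,finite} gauss" where "z * z = gi" "z * gconj z = -1"
proof -
  have "\<chi> (-2 :: 'a) = 1"
    using quad_char_minus[OF q, of 2] two by simp
  then obtain r :: 'a where r: "-2 = r ^ 2" and "(-2 :: 'a) \<noteq> 0"
    by (auto simp: quad_char_def split: if_splits)
  then have r0: "r \<noteq> 0" by auto
  \<comment> \<open>\<open>(1 - i) / r\<close> has the coordinates \<open>s\<close> and \<open>- s\<close>.\<close>
  define s where "s = 1 / r"
  have "s * s * r ^ 2 = 1"
    using r0 by (simp add: s_def power2_eq_square)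
  then have "s * s * - 2 = 1" using r by simp
  then have "- (2 * (s * s)) = 1" by (simp add: mult.commute)
  then have s: "2 * (s * s) = -1" by (metis minus_minus)
  have s': "s * s + s * s = -1" using s by simp
  show ?thesis
  proof (rule that[of "Gauss s (- s)"])
    show "Gauss s (- s) * Gauss s (- s) = gi"
      using s' by (simp add: gauss_eq_iff)
    show "Gauss s (- s) * gconj (Gauss s (- s)) = -1"
      using s' by (simp add: gauss_eq_iff)
  qed
qed

section \<open>The moment as a sum over the circle\<close>

text \<open>
  The constant is a doubled cosine: \<open>2 z\<^sup>2 - 1 = cos (2 \<alpha>)\<close> for \<open>z = cos \<alpha>\<close>. In terms of \<open>x = re w\<close> the sum is over
  the cubic \<open>(x\<^sup>2 - 1) (x + 2 z\<^sup>2 - 1)\<close>, which \<open>x = 2 s + 1\<close> takes to \<open>8 s (s + 1) (s + z\<^sup>2)\<close>.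
\<close>

lemma sum_circle_quad_char:
  fixes z :: "'a::{field,finite}"
  assumes q: "CARD('a) mod 4 = 3" and two: "\<chi> (2::'a) = -1"
  shows "(\<Sum>w\<in>unit_circle. \<chi> (2 * z ^ 2 - 1 + re w)) = - legendre_sum z"
proof -
  note odd = odd_if_3_mod_4[OF q]
  have two0: "(2::'a) \<noteq> 0" using two by auto
  have "(\<Sum>w\<in>unit_circle. \<chi> (2 * z ^ 2 - 1 + re w))
      = (\<Sum>x\<in>UNIV. (1 - \<chi> (x ^ 2 - 1)) * \<chi> (2 * z ^ 2 - 1 + x))"
    by (rule sum_unit_circle[OF q])
  also have "\<dots> = (\<Sum>x\<in>UNIV. \<chi> (1 * x + (2 * z ^ 2 - 1))) - (\<Sum>x\<in>UNIV. \<chi> (x ^ 2 - 1) * \<chi> (2 * z ^ 2 - 1 + x))"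
    by (simp add: left_diff_distrib sum_subtractf add.commute)
  also have "(\<Sum>x\<in>UNIV. \<chi> (1 * x + (2 * z ^ 2 - 1))) = 0"
    by (rule sum_quad_char_linear[OF odd]) simp
  also have "(\<Sum>x\<in>UNIV. \<chi> (x ^ 2 - 1) * \<chi> (2 * z ^ 2 - 1 + x))
      = (\<Sum>s\<in>UNIV. \<chi> ((2 * s + 1) ^ 2 - 1) * \<chi> (2 * z ^ 2 - 1 + (2 * s + 1)))"
    by (rule sum_affine[OF two0])
  also have "\<dots> = (\<Sum>s\<in>UNIV. - (\<chi> s * \<chi> (s + 1) * \<chi> (s + z ^ 2)))"
  proof (intro sum.cong refl)
    fix s :: 'a
    have 1: "(2 * s + 1) ^ 2 - 1 = 2 ^ 2 * (s * (s + 1))"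
      and 2: "2 * z ^ 2 - 1 + (2 * s + 1) = 2 * (s + z ^ 2)"
      by (simp_all add: power2_eq_square algebra_simps)
    show "\<chi> ((2 * s + 1) ^ 2 - 1) * \<chi> (2 * z ^ 2 - 1 + (2 * s + 1)) = - (\<chi> s * \<chi> (s + 1) * \<chi> (s + z ^ 2))"
      unfolding 1 2 quad_char_mult_square[OF odd two0]
      unfolding quad_char_mult[OF odd] two by simp
  qed
  also have "\<dots> = legendre_sum z"
    by (simp add: sum_negf legendre_sum_eq_neg[OF q])
  finally show ?thesis by simp
qed

lemma sum_legendre_sum:
  assumes q: "CARD('a::{field,finite}) mod 4 = 3"
  shows "(\<Sum>z\<in>(UNIV::'a set). legendre_sum z) = -1"
proof -
  note odd = odd_if_3_mod_4[OF q]
  have inner: "\<chi> s * (\<Sum>z\<in>UNIV. \<chi> (s - z ^ 2)) = \<chi> s" for s :: 'a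
  proof (cases "s = 0")
    case False
    have m: "\<chi> (s - z) = - \<chi> (z + - s)" for z
      using quad_char_minus[OF q, of "z + - s"] by simp
    have "(\<Sum>z\<in>UNIV. \<chi> (s - z ^ 2)) = (\<Sum>z\<in>UNIV. (1 + \<chi> z) * \<chi> (s - z))"
      by (rule sum_squares[OF odd])
    also have "\<dots> = - (\<Sum>z\<in>UNIV. \<chi> (1 * z + - s)) - (\<Sum>z\<in>UNIV. \<chi> (z + 0) * \<chi> (z + - s))"
      unfolding m by (simp add: algebra_simps sum.distrib sum_negf sum_subtractf)
    also have "(\<Sum>z\<in>UNIV. \<chi> (1 * z + - s)) = 0"
      by (rule sum_quad_char_linear[OF odd]) simp
    also have "(\<Sum>z\<in>UNIV. \<chi> (z + 0) * \<chi> (z + - s)) = -1"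
      using False by (subst sum_quad_char_quadratic[OF odd]) simp
    finally show ?thesis by simp
  qed simp
  have "(\<Sum>z\<in>(UNIV::'a set). legendre_sum z)
      = (\<Sum>s\<in>UNIV. \<Sum>z\<in>(UNIV::'a set). \<chi> s * \<chi> (s - 1) * \<chi> (s - z ^ 2))"
    unfolding legendre_sum_def by (rule sum.swap)
  also have "\<dots> = (\<Sum>s\<in>UNIV. \<chi> (s - 1) * (\<chi> s * (\<Sum>z\<in>(UNIV::'a set). \<chi> (s - z ^ 2))))"
    by (simp add: sum_distrib_left mult_ac)
  also have "\<dots> = (\<Sum>s\<in>(UNIV::'a set). \<chi> (s + 0) * \<chi> (s + -1))"
    unfolding inner by (simp add: mult.commute)
  also have "\<dots> = -1"
    by (subst sum_quad_char_quadratic[OF odd]) simp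
  finally show ?thesis .
qed

text \<open>
  A sum over \<open>Z = z\<^sup>2\<close> with weight \<open>1 + \<chi> Z\<close>. The part with \<open>\<chi> Z\<close> has the summand
  \<open>\<chi> (Z (Z - 1) s (s - 1) (s - Z))\<close>, which is antisymmetric in \<open>s\<close> and \<open>Z\<close> as \<open>\<chi> (- 1) = - 1\<close>.
\<close>

lemma sum_legendre_sum_twisted:
  assumes q: "CARD('a::{field,finite}) mod 4 = 3"
  shows "(\<Sum>z\<in>(UNIV::'a set). \<chi> (z ^ 2 - 1) * legendre_sum z) = -1"
proof -
  note odd = odd_if_3_mod_4[OF q]
  define T where "T Z = (\<Sum>s\<in>(UNIV::'a set). \<chi> s * \<chi> (s - 1) * \<chi> (s - Z))" for Z :: 'a
  have "(\<Sum>z\<in>(UNIV::'a set). \<chi> (z ^ 2 - 1) * legendre_sum z) = (\<Sum>z\<in>(UNIV::'a set). \<chi> (z ^ 2 - 1) * T (z ^ 2))"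
    by (simp add: legendre_sum_def T_def)
  also have "\<dots> = (\<Sum>Z\<in>(UNIV::'a set). (1 + \<chi> Z) * (\<chi> (Z - 1) * T Z))"
    by (rule sum_squares[OF odd])
  also have "\<dots> = (\<Sum>Z\<in>(UNIV::'a set). \<chi> (Z - 1) * T Z) + (\<Sum>Z\<in>(UNIV::'a set). \<chi> Z * \<chi> (Z - 1) * T Z)"
    by (simp add: distrib_right sum.distrib mult.assoc)
  also have "(\<Sum>Z\<in>(UNIV::'a set). \<chi> (Z - 1) * T Z) = -1"
  proof -
    have m: "\<chi> (Z - 1) * (\<chi> s * \<chi> (s - 1) * \<chi> (s - Z))
        = - (\<chi> s * \<chi> (s - 1)) * (\<chi> (Z + -1) * \<chi> (Z + - s))" for s Z :: 'a
      using quad_char_minus[OF q, of "Z + - s"] by simp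
    have "(\<Sum>Z\<in>(UNIV::'a set). \<chi> (Z - 1) * T Z) = (\<Sum>Z\<in>(UNIV::'a set). \<Sum>s\<in>(UNIV::'a set). - (\<chi> s * \<chi> (s - 1)) * (\<chi> (Z + -1) * \<chi> (Z + - s)))"
      unfolding T_def sum_distrib_left m ..
    also have "\<dots> = (\<Sum>s\<in>(UNIV::'a set). \<Sum>Z\<in>(UNIV::'a set). - (\<chi> s * \<chi> (s - 1)) * (\<chi> (Z + -1) * \<chi> (Z + - s)))"
      by (rule sum.swap)
    also have "\<dots> = (\<Sum>s\<in>(UNIV::'a set). - (\<chi> s * \<chi> (s - 1)) * (\<Sum>Z\<in>(UNIV::'a set). \<chi> (Z + -1) * \<chi> (Z + - s)))"
      by (simp only: sum_distrib_left)
    also have "\<dots> = (\<Sum>s\<in>(UNIV::'a set). \<chi> (s + 0) * \<chi> (s + -1))"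
      by (rule sum.cong[OF refl], subst sum_quad_char_quadratic[OF odd]) auto
    also have "\<dots> = -1"
      by (subst sum_quad_char_quadratic[OF odd]) simp
    finally show ?thesis .
  qed
  also have "(\<Sum>Z\<in>(UNIV::'a set). \<chi> Z * \<chi> (Z - 1) * T Z) = 0"
  proof -
    define D where "D Z s = \<chi> Z * \<chi> (Z - 1) * (\<chi> s * \<chi> (s - 1) * \<chi> (s - Z))" for Z s :: 'a
    have D: "D s Z = - D Z s" for s Z
      using quad_char_minus[OF q, of "s - Z"] by (simp add: D_def)
    have "(\<Sum>Z\<in>(UNIV::'a set). \<chi> Z * \<chi> (Z - 1) * T Z) = (\<Sum>Z\<in>(UNIV::'a set). \<Sum>s\<in>(UNIV::'a set). D Z s)"
      by (simp add: T_def D_def sum_distrib_left)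
    moreover have "(\<Sum>Z\<in>(UNIV::'a set). \<Sum>s\<in>(UNIV::'a set). D Z s) = (\<Sum>s\<in>(UNIV::'a set). \<Sum>Z\<in>(UNIV::'a set). D Z s)"
      by (rule sum.swap)
    moreover have "(\<Sum>s\<in>(UNIV::'a set). \<Sum>Z\<in>(UNIV::'a set). D Z s) = (\<Sum>s\<in>(UNIV::'a set). \<Sum>Z\<in>(UNIV::'a set). - D s Z)"
      by (intro sum.cong refl) (rule D)
    moreover have "\<dots> = - (\<Sum>s\<in>(UNIV::'a set). \<Sum>Z\<in>(UNIV::'a set). D s Z)"
      by (simp only: sum_negf)
    ultimately show ?thesis by linarith
  qed
  finally show ?thesis by simp
qed

text \<open>
  With \<open>z = 2 (re w)\<^sup>2 - 1\<close> the weight of \<open>z\<close> is \<open>(1 - \<chi> (z + 1)) (1 + \<chi> (z - 1))\<close>. The two mixed terms both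
  give \<open>- L\<close>, since the Legendre sum is even in \<open>z\<close>, and the two outer terms cancel.
\<close>

lemma sum_circle_legendre_sum:
  assumes q: "CARD('a::{field,finite}) mod 4 = 3" and two: "\<chi> (2::'a) = -1"
  shows "(\<Sum>w\<in>(unit_circle :: 'a gauss set). legendre_sum (2 * re w ^ 2 - 1)) = - 2 * legendre_moment TYPE('a)"
proof -
  note odd = odd_if_3_mod_4[OF q]
  have two0: "(2::'a) \<noteq> 0" using two by auto
  have "(\<Sum>w\<in>(unit_circle :: 'a gauss set). legendre_sum (2 * re w ^ 2 - 1))
      = (\<Sum>x\<in>(UNIV::'a set). (1 - \<chi> (x ^ 2 - 1)) * legendre_sum (2 * x ^ 2 - 1))"
    by (rule sum_unit_circle[OF q])
  also have "\<dots> = (\<Sum>Y\<in>(UNIV::'a set). (1 + \<chi> Y) * ((1 - \<chi> (Y - 1)) * legendre_sum (2 * Y - 1)))"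
    by (rule sum_squares[OF odd])
  also have "\<dots> = (\<Sum>Y\<in>(UNIV::'a set). (1 - \<chi> (2 * Y + -1 + 1)) * ((1 + \<chi> (2 * Y + -1 - 1)) * legendre_sum (2 * Y + -1)))"
  proof (intro sum.cong refl)
    fix Y :: 'a
    have "\<chi> (2 * Y + -1 + 1) = - \<chi> Y"
      by (simp add: quad_char_mult[OF odd] two)
    moreover have "2 * Y + -1 - 1 = 2 * (Y - 1)" by (simp add: algebra_simps)
    then have "\<chi> (2 * Y + -1 - 1) = - \<chi> (Y - 1)"
      by (simp only: quad_char_mult[OF odd] two)
    ultimately show "(1 + \<chi> Y) * ((1 - \<chi> (Y - 1)) * legendre_sum (2 * Y - 1))
      = (1 - \<chi> (2 * Y + -1 + 1)) * ((1 + \<chi> (2 * Y + -1 - 1)) * legendre_sum (2 * Y + -1))"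
      by simp
  qed
  also have "\<dots> = (\<Sum>z\<in>(UNIV::'a set). (1 - \<chi> (z + 1)) * ((1 + \<chi> (z - 1)) * legendre_sum z))"
    by (rule sum_affine[OF two0, symmetric])
  also have "\<dots> = (\<Sum>z\<in>(UNIV::'a set). legendre_sum z - \<chi> (z + 1) * legendre_sum z
      + \<chi> (z - 1) * legendre_sum z - \<chi> (z ^ 2 - 1) * legendre_sum z)"
  proof (intro sum.cong refl)
    fix z :: 'a
    have "z ^ 2 - 1 = (z + 1) * (z - 1)" by (simp add: power2_eq_square algebra_simps)
    then have "\<chi> (z ^ 2 - 1) = \<chi> (z + 1) * \<chi> (z - 1)"
      by (simp only: quad_char_mult[OF odd])
    then show "(1 - \<chi> (z + 1)) * ((1 + \<chi> (z - 1)) * legendre_sum z)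
        = legendre_sum z - \<chi> (z + 1) * legendre_sum z + \<chi> (z - 1) * legendre_sum z - \<chi> (z ^ 2 - 1) * legendre_sum z"
      by (simp add: algebra_simps)
  qed
  also have "\<dots> = (\<Sum>z\<in>(UNIV::'a set). legendre_sum z) - (\<Sum>z\<in>(UNIV::'a set). \<chi> (z + 1) * legendre_sum z)
      + (\<Sum>z\<in>(UNIV::'a set). \<chi> (z - 1) * legendre_sum z) - (\<Sum>z\<in>(UNIV::'a set). \<chi> (z ^ 2 - 1) * legendre_sum z)"
    by (simp only: sum.distrib sum_subtractf)
  also have "(\<Sum>z\<in>(UNIV::'a set). \<chi> (z - 1) * legendre_sum z) = - legendre_moment TYPE('a)"
  proof -
    have "(\<Sum>z\<in>(UNIV::'a set). \<chi> (z - 1) * legendre_sum z)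
        = (\<Sum>z\<in>(UNIV::'a set). \<chi> (-1 * z + 0 - 1) * legendre_sum (-1 * z + 0))"
      by (rule sum_affine) simp
    also have "\<dots> = (\<Sum>z\<in>(UNIV::'a set). - (\<chi> (z + 1) * legendre_sum z))"
    proof (intro sum.cong refl)
      fix z :: 'a
      show "\<chi> (-1 * z + 0 - 1) * legendre_sum (-1 * z + 0) = - (\<chi> (z + 1) * legendre_sum z)"
        using quad_char_minus[OF q, of "z + 1"] by (simp add: legendre_sum_neg)
    qed
    finally show ?thesis by (simp add: legendre_moment_def sum_negf)
  qed
  finally show ?thesis
    unfolding sum_legendre_sum[OF q] sum_legendre_sum_twisted[OF q] legendre_moment_def by simp
qed

text \<open>
  Both sides come from the sum of \<open>\<chi> (re a + re w)\<close> over \<open>a\<close> in the odd part and \<open>w\<close> on the whole circle.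
  Splitting \<open>w\<close> along the fourth roots of unity gives the cosine sums. On the other hand \<open>u \<mapsto> u\<^sup>4\<close> maps the circle
  four-to-one onto the odd part, so \<open>a\<close> may be replaced by \<open>u\<^sup>4\<close>; as \<open>re (u\<^sup>4)\<close> is the cosine polynomial
  \<open>2 (2 (re u)\<^sup>2 - 1)\<^sup>2 - 1\<close>, the sum over \<open>w\<close> is a Legendre sum.
\<close>

lemma legendre_moment_eq_cos_sums:
  fixes z :: "'a::{field,finite} gauss"
  assumes pn: "prime p" "CARD('a) = p ^ n" and q: "CARD('a) mod 8 = 3" and two: "\<chi> (2::'a) = -1"
    and z: "z * z = gi" "z * gconj z = -1"
  shows "legendre_moment TYPE('a) = 4 * cos_sum z ^ 2 - 2 * cos_sum (1::'a gauss) ^ 2"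
proof -
  have q4: "CARD('a) mod 4 = 3" using q by presburger
  define M where "M = (\<Sum>a\<in>(odd_part :: 'a gauss set). \<Sum>w\<in>unit_circle. \<chi> (re a + re (w :: 'a gauss)))"
  have "M = cos_pair_sum (1 :: 'a gauss) + cos_pair_sum (-1 :: 'a gauss) + cos_pair_sum (gi :: 'a gauss) + cos_pair_sum (- gi :: 'a gauss)"
    unfolding M_def sum_unit_circle_decomposition[OF pn q] cos_pair_sum_def sum.distrib by simp
  then have M: "M = 2 * cos_sum z ^ 2 - cos_sum (1::'a gauss) ^ 2"
    by (simp add: cos_pair_sum_minus_1[OF q4] cos_pair_sum_minus_gi
        cos_sum_1_square[OF q two] cos_sum_zeta_square[OF q two z])
  have "2 * legendre_moment TYPE('a) = (\<Sum>u\<in>(unit_circle :: 'a gauss set). - legendre_sum (2 * re u ^ 2 - 1))"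
    using sum_circle_legendre_sum[OF q4 two] by (simp add: sum_negf)
  also have "\<dots> = (\<Sum>u\<in>(unit_circle :: 'a gauss set). \<Sum>w\<in>unit_circle. \<chi> (re (u ^ 4) + re (w :: 'a gauss)))"
  proof (rule sum.cong[OF refl])
    fix u :: "'a gauss" assume "u \<in> unit_circle"
    have re2: "re (v * v) = 2 * re v ^ 2 - 1" if "v \<in> unit_circle" for v :: "'a gauss"
    proof -
      have "im v ^ 2 = 1 - re v ^ 2" using that unfolding unit_circle_iff by (simp add: eq_diff_eq add.commute)
      then show ?thesis by (simp add: power2_eq_square)
    qed
    have "re (u ^ 4) = 2 * (2 * re u ^ 2 - 1) ^ 2 - 1"
    proof -
      have "u ^ 4 = (u * u) * (u * u)" by (simp add: power4_eq_xxxx mult.assoc)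
      moreover have "u * u \<in> unit_circle" using \<open>u \<in> unit_circle\<close> by (simp add: unit_circle_mult)
      ultimately show ?thesis using re2[of "u * u"] re2[OF \<open>u \<in> unit_circle\<close>] by simp
    qed
    then show "- legendre_sum (2 * re u ^ 2 - 1) = (\<Sum>w\<in>unit_circle. \<chi> (re (u ^ 4) + re (w :: 'a gauss)))"
      by (simp only: sum_circle_quad_char[OF q4 two])
  qed
  also have "\<dots> = 4 * M"
  proof -
    define f where "f u = (\<Sum>w\<in>unit_circle. \<chi> (re u + re (w :: 'a gauss)))" for u :: "'a gauss"
    have "(\<Sum>u\<in>unit_circle. f (u ^ 4)) = (\<Sum>v\<in>odd_part. f (v ^ 4) + f ((- v) ^ 4) + f ((gi * v) ^ 4) + f ((- gi * v) ^ 4))"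
      by (rule sum_unit_circle_decomposition[OF pn q])
    also have "\<dots> = 4 * (\<Sum>v\<in>odd_part. f ((v ^ 2) ^ 2))"
    proof -
      have "(- gi * v) ^ 4 = v ^ 4" "(gi * v) ^ 4 = v ^ 4" for v :: "'a gauss"
        by (simp_all add: power_mult_distrib gi_power_4)
      then show ?thesis by (simp add: sum_distrib_left flip: power_mult)
    qed
    also have "(\<Sum>v\<in>odd_part. f ((v ^ 2) ^ 2)) = (\<Sum>v\<in>odd_part. f v)"
      by (simp only: sum_odd_part_square[OF q, of "\<lambda>v. f (v ^ 2)"] sum_odd_part_square[OF q, of f])
    finally show ?thesis by (simp add: f_def M_def)
  qed
  finally show ?thesis using M by simp
qed

section \<open>The norm equation\<close>

lemma minus_1_notin_odd_part:
  assumes "CARD('a::{field,finite}) mod 8 = 3"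
  shows "(-1 :: 'a gauss) \<notin> odd_part"
proof
  assume "(-1 :: 'a gauss) \<in> odd_part"
  moreover have "odd ((CARD('a) + 1) div 4)" using assms by presburger
  ultimately have "(-1 :: 'a gauss) = 1" by (simp add: odd_part_def)
  then have "(2::'a) = 0" by (simp add: gauss_eq_iff)
  moreover have "odd CARD('a)" using assms by presburger
  ultimately show False using two_neq_0_if_odd_card by blast
qed

lemma unit_circle_real_if_re_square_1:
  fixes w :: "'a::field gauss"
  assumes "w \<in> unit_circle" "re w ^ 2 = 1"
  shows "w = of_base (re w)"
  using assms by (simp add: unit_circle_iff gauss_eq_iff)

text \<open>
  The half-angle formula: \<open>1 + re (u\<^sup>2) = 2 (re u)\<^sup>2\<close> for \<open>u\<close> of norm \<open>1\<close>, and \<open>re (u\<^sup>2) - 1 = 2 (re u)\<^sup>2\<close> for \<open>u\<close> of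
  norm \<open>- 1\<close>. In the latter case \<open>(re w - 1) (re w + 1) = - (im w)\<^sup>2\<close> moves from the one factor to the other. So
  \<open>1 + re w\<close> tells the squares of the circle from the remaining elements.
\<close>

lemma quad_char_1_plus_re:
  fixes w :: "'a::{field,finite} gauss"
  assumes q: "CARD('a) mod 4 = 3" and two: "\<chi> (2::'a) = -1"
    and w: "w \<in> unit_circle" and "w = u * u"
  shows "u * gconj u = 1 \<Longrightarrow> w \<noteq> -1 \<Longrightarrow> \<chi> (1 + re w) = -1"
    and "u * gconj u = -1 \<Longrightarrow> w \<noteq> 1 \<Longrightarrow> w \<noteq> -1 \<Longrightarrow> \<chi> (1 + re w) = 1"
proof -
  note odd = odd_if_3_mod_4[OF q]
  have two0: "(2::'a) \<noteq> 0" using two by auto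
  have re_neq: "re w \<noteq> 1" if "w \<noteq> 1"
  proof
    assume "re w = 1"
    then have "w = of_base 1" using unit_circle_real_if_re_square_1[OF w] by simp
    then show False using that by (simp add: gauss_eq_iff)
  qed
  have re_neq': "re w \<noteq> -1" if "w \<noteq> -1"
  proof
    assume "re w = -1"
    then have "w = of_base (-1)" using unit_circle_real_if_re_square_1[OF w] by simp
    then show False using that by (simp add: gauss_eq_iff)
  qed
  have norm: "re (u * gconj u) = re u ^ 2 + im u ^ 2"
    by (simp add: power2_eq_square)
  have sq: "\<chi> (2 * x ^ 2) = -1" if "2 * x ^ 2 \<noteq> 0" for x :: 'a
    using that two by (simp add: quad_char_mult[OF odd])
  {
    assume u: "u * gconj u = 1" and "w \<noteq> -1"
    have "re u ^ 2 + im u ^ 2 = 1" using norm u by simp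
    then have "1 + re w = 2 * re u ^ 2"
      using assms(4) by (simp add: power2_eq_square algebra_simps)
    moreover have "1 + re w \<noteq> 0"
      using re_neq'[OF \<open>w \<noteq> -1\<close>] by (metis add.commute add_eq_0_iff)
    ultimately show "\<chi> (1 + re w) = -1" using sq by metis
  next
    assume u: "u * gconj u = -1" and "w \<noteq> 1" "w \<noteq> -1"
    have "re u ^ 2 + im u ^ 2 = -1" using norm u by simp
    then have "im u ^ 2 = -1 - re u ^ 2" by (simp add: algebra_simps)
    then have "re w - 1 = 2 * re u ^ 2"
      using assms(4) by (simp add: power2_eq_square)
    moreover have "re w - 1 \<noteq> 0" using re_neq[OF \<open>w \<noteq> 1\<close>] by simp
    ultimately have 1: "\<chi> (re w - 1) = -1" using sq by metis
    have im: "im w \<noteq> 0"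
    proof
      assume "im w = 0"
      then have "(re w - 1) * (re w + 1) = 0"
        using w by (simp add: unit_circle_iff power2_eq_square algebra_simps)
      then show False using re_neq[OF \<open>w \<noteq> 1\<close>] re_neq'[OF \<open>w \<noteq> -1\<close>]
        by (simp add: eq_neg_iff_add_eq_0)
    qed
    have "im w ^ 2 = 1 - re w ^ 2" using w unfolding unit_circle_iff by (simp add: eq_diff_eq add.commute)
    then have "(re w - 1) * (1 + re w) = - (im w ^ 2)"
      by (simp add: power2_eq_square algebra_simps)
    then have "\<chi> ((re w - 1) * (1 + re w)) = -1"
      using im by (simp add: quad_char_minus[OF q])
    then show "\<chi> (1 + re w) = 1" by (simp add: quad_char_mult[OF odd] 1)
  }
qed

text \<open>
  The weight \<open>1 - \<chi> (x\<^sup>2 - 1)\<close> of \<open>x = re w\<close> meets the factor \<open>\<chi> (x + 1)\<close>, and \<open>\<chi> (x\<^sup>2 - 1) \<chi> (x + 1) = \<chi> (x - 1)\<close>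
  unless \<open>x = - 1\<close>. So only quadratic polynomials remain.
\<close>

lemma sum_circle_half_angle:
  fixes T :: "'a::{field,finite}"
  assumes q: "CARD('a) mod 4 = 3" and two: "\<chi> (2::'a) = -1"
  shows "(\<Sum>w\<in>unit_circle. \<chi> (1 + re w) * \<chi> (T + re w))
       = \<chi> (T - 1) + (if T = 1 then int CARD('a) else 0) - (if T = -1 then int CARD('a) else 0)"
proof -
  note odd = odd_if_3_mod_4[OF q]
  have "(\<Sum>w\<in>unit_circle. \<chi> (1 + re w) * \<chi> (T + re w))
      = (\<Sum>x\<in>UNIV. (1 - \<chi> (x ^ 2 - 1)) * (\<chi> (1 + x) * \<chi> (T + x)))"
    by (rule sum_unit_circle[OF q])
  also have "\<dots> = (\<Sum>x\<in>UNIV. \<chi> (x + 1) * \<chi> (x + T) - \<chi> (x + -1) * \<chi> (x + T) + (if x = -1 then \<chi> (T - 1) else 0))"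
  proof (intro sum.cong refl)
    fix x :: 'a
    have "x ^ 2 - 1 = (x + -1) * (x + 1)" by (simp add: power2_eq_square algebra_simps)
    then have x: "\<chi> (x ^ 2 - 1) = \<chi> (x + -1) * \<chi> (x + 1)"
      by (simp only: quad_char_mult[OF odd])
    show "(1 - \<chi> (x ^ 2 - 1)) * (\<chi> (1 + x) * \<chi> (T + x))
        = \<chi> (x + 1) * \<chi> (x + T) - \<chi> (x + -1) * \<chi> (x + T) + (if x = -1 then \<chi> (T - 1) else 0)"
    proof (cases "x = -1")
      case True
      have "\<chi> (-2 :: 'a) = 1" using quad_char_minus[OF q, of 2] two by simp
      then show ?thesis using True by simp
    next
      case False
      then have "x + 1 \<noteq> 0" by (simp add: eq_neg_iff_add_eq_0)
      then have "\<chi> (x + 1) * \<chi> (x + 1) = 1" by simp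
      then have "\<chi> (x ^ 2 - 1) * \<chi> (1 + x) = \<chi> (x + -1)"
        by (simp only: x mult.assoc add.commute[of 1 x] mult_1_right)
      then show ?thesis using False by (simp add: left_diff_distrib mult.assoc[symmetric] add.commute)
    qed
  qed
  also have "\<dots> = (\<Sum>x\<in>UNIV. \<chi> (x + 1) * \<chi> (x + T)) - (\<Sum>x\<in>UNIV. \<chi> (x + -1) * \<chi> (x + T)) + \<chi> (T - 1)"
    by (simp only: sum.distrib sum_subtractf) simp
  finally show ?thesis
    by (simp only: sum_quad_char_quadratic[OF odd]) auto
qed

lemma one_in_odd_part: "1 \<in> odd_part"
  by (simp add: odd_part_def unit_circle_iff)

text \<open>
  Let \<open>e w\<close> be \<open>1\<close> if \<open>w\<close> is a square of the circle and \<open>- 1\<close> otherwise. The sum of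
  \<open>e w * \<chi> (re a + re w)\<close> over \<open>a\<close> in the odd part and \<open>w\<close> on the circle is \<open>- (A\<^sup>2 + 2 B\<^sup>2)\<close> by the decomposition of the
  circle. The half-angle formula makes \<open>e\<close> explicit, and then the sum over \<open>w\<close> vanishes except for \<open>a = 1\<close>, where it is \<open>- q\<close>.
\<close>

lemma card_eq_cos_sums:
  fixes z :: "'a::{field,finite} gauss"
  assumes pn: "prime p" "CARD('a) = p ^ n" and q: "CARD('a) mod 8 = 3" and two: "\<chi> (2::'a) = -1"
    and z: "z * z = gi" "z * gconj z = -1"
  shows "cos_sum (1::'a gauss) ^ 2 + 2 * cos_sum z ^ 2 = int CARD('a)"
proof -
  have q4: "CARD('a) mod 4 = 3" using q by presburger
  \<comment> \<open>At \<open>w = - 1\<close>, a square, the half-angle character vanishes and has to be corrected by \<open>1\<close>.\<close>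
  define e where "e w = (if w = -1 then 1 else 0) - \<chi> (1 + re w)" for w :: "'a gauss"
  have unit: "v \<in> unit_circle" if "v \<in> odd_part" for v :: "'a gauss"
    using that by (simp add: odd_part_def)
  have gi_unit: "gi \<in> (unit_circle :: 'a gauss set)" "- gi \<in> (unit_circle :: 'a gauss set)"
      "- 1 \<in> (unit_circle :: 'a gauss set)"
    by (simp_all add: unit_circle_iff)
  have e: "e v = 1" "e (- v) = 1" "e (gi * v) = -1" "e (- gi * v) = -1" if v: "v \<in> odd_part" for v :: "'a gauss"
  proof -
    have "v \<in> (\<lambda>v. v ^ 2) ` odd_part"
      using v bij_betw_imp_surj_on[OF bij_betw_odd_part_square[OF q]] by blast
    then obtain b where b: "b \<in> odd_part" "v = b * b"
      unfolding power2_eq_square by blast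
    note bb = odd_part_unit[OF b(1)]
    have v_ne: "v \<noteq> -1" using v minus_1_notin_odd_part[OF q] by blast
    have "v * v \<in> odd_part" using v by (simp add: odd_part_mult)
    then have vv_ne: "v * v \<noteq> -1" using minus_1_notin_odd_part[OF q] by metis
    show "e v = 1"
      using quad_char_1_plus_re(1)[OF q4 two unit[OF v] b(2) bb v_ne] v_ne by (simp add: e_def)
    have mv: "- v \<in> unit_circle"
      using unit_circle_mult[OF gi_unit(3) unit[OF v]] by simp
    show "e (- v) = 1"
    proof (cases "- v = -1")
      case False
      have "(gi * b) * (gi * b) = (gi * gi) * (b * b)" by (simp only: mult_ac)
      then have m1: "- v = (gi * b) * (gi * b)" by (simp add: b(2) gi_square)
      have "(gi * b) * gconj (gi * b) = (gi * gconj gi) * (b * gconj b)"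
        by (simp only: gconj_mult mult_ac)
      then have m2: "(gi * b) * gconj (gi * b) = 1"
        using gi_unit(1) bb by (simp add: unit_circle_def)
      show ?thesis
        using quad_char_1_plus_re(1)[OF q4 two mv m1 m2 False] False by (simp add: e_def)
    qed (simp add: e_def)
    have gv_ne: "g * v \<noteq> 1" "g * v \<noteq> -1" if "g * g = -1" for g :: "'a gauss"
    proof -
      have "(g * v) * (g * v) = (g * g) * (v * v)" by (simp only: mult_ac)
      then have gv: "(g * v) * (g * v) = - (v * v)" using that by simp
      show "g * v \<noteq> 1"
      proof
        assume "g * v = 1"
        then have "- (v * v) = 1" using gv by simp
        then have "- (- (v * v)) = -1" by (rule arg_cong)
        then show False using vv_ne by simp
      qed
      show "g * v \<noteq> -1"
      proof
        assume "g * v = -1"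
        then have "- (v * v) = 1" using gv by simp
        then have "- (- (v * v)) = -1" by (rule arg_cong)
        then show False using vv_ne by simp
      qed
    qed
    have "gi * v \<in> unit_circle" using gi_unit(1) unit[OF v] by (rule unit_circle_mult)
    moreover have "gi * v = (z * b) * (z * b)"
      by (simp only: b(2) z(1)[symmetric] mult_ac)
    moreover have "(z * b) * gconj (z * b) = (z * gconj z) * (b * gconj b)"
      by (simp only: gconj_mult mult_ac)
    then have zb: "(z * b) * gconj (z * b) = -1" using z(2) bb by simp
    ultimately have "\<chi> (1 + re (gi * v)) = 1"
      using quad_char_1_plus_re(2)[OF q4 two] gv_ne[OF gi_square] by blast
    then show "e (gi * v) = -1" using gv_ne(2)[OF gi_square] by (simp only: e_def) simp
    have "- gi * v \<in> unit_circle" using gi_unit(2) unit[OF v] by (rule unit_circle_mult)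
    moreover have "- gi * v = (gi * (z * b)) * (gi * (z * b))"
    proof -
      have "(gi * (z * b)) * (gi * (z * b)) = (gi * gi) * ((z * z) * (b * b))"
        by (simp only: mult_ac)
      then show ?thesis by (simp add: gi_square z(1) b(2))
    qed
    moreover have "(gi * (z * b)) * gconj (gi * (z * b)) = (gi * gconj gi) * ((z * b) * gconj (z * b))"
      by (simp only: gconj_mult mult_ac)
    then have "(gi * (z * b)) * gconj (gi * (z * b)) = -1"
      using gi_unit(1) zb by (simp add: unit_circle_def)
    moreover have "(- gi) * (- gi) = (-1 :: 'a gauss)" by (simp add: gi_square)
    ultimately have "\<chi> (1 + re (- gi * v)) = 1"
      using quad_char_1_plus_re(2)[OF q4 two] gv_ne by blast
    then show "e (- gi * v) = -1"
      using gv_ne(2)[OF \<open>(- gi) * (- gi) = -1\<close>] by (simp only: e_def) simp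
  qed
  have "(\<Sum>a\<in>odd_part. \<Sum>w\<in>unit_circle. e w * \<chi> (re a + re (w :: 'a gauss)))
      = (\<Sum>a\<in>(odd_part :: 'a gauss set). \<Sum>v\<in>odd_part. \<chi> (re a + re (1 * v)) + \<chi> (re a + re (-1 * v))
          - \<chi> (re a + re (gi * v)) - \<chi> (re a + re (- gi * v)))"
    unfolding sum_unit_circle_decomposition[OF pn q]
    by (intro sum.cong refl) (simp add: e del: gauss_components mult_minus_left)
  also have "\<dots> = cos_pair_sum (1 :: 'a gauss) + cos_pair_sum (-1 :: 'a gauss)
      - cos_pair_sum (gi :: 'a gauss) - cos_pair_sum (- gi :: 'a gauss)"
    by (simp only: cos_pair_sum_def sum.distrib sum_subtractf)
  also have "\<dots> = - (cos_sum (1::'a gauss) ^ 2 + 2 * cos_sum z ^ 2)"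
    by (simp add: cos_pair_sum_minus_1[OF q4] cos_pair_sum_minus_gi
        cos_sum_1_square[OF q two] cos_sum_zeta_square[OF q two z])
  finally have lhs: "(\<Sum>a\<in>odd_part. \<Sum>w\<in>unit_circle. e w * \<chi> (re a + re (w :: 'a gauss)))
      = - (cos_sum (1::'a gauss) ^ 2 + 2 * cos_sum z ^ 2)" .
  have "(\<Sum>a\<in>odd_part. \<Sum>w\<in>unit_circle. e w * \<chi> (re a + re (w :: 'a gauss)))
      = (\<Sum>a\<in>(odd_part :: 'a gauss set). if a = 1 then - int CARD('a) else 0)"
  proof (rule sum.cong[OF refl])
    fix a :: "'a gauss" assume a: "a \<in> odd_part"
    have "(\<Sum>w\<in>unit_circle. e w * \<chi> (re a + re w))
        = (\<Sum>w\<in>unit_circle. (if w = -1 then \<chi> (re a - 1) else 0) - \<chi> (1 + re w) * \<chi> (re a + re w))"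
      by (intro sum.cong refl) (simp add: e_def left_diff_distrib)
    also have "\<dots> = \<chi> (re a - 1) - (\<Sum>w\<in>unit_circle. \<chi> (1 + re w) * \<chi> (re a + re w))"
      using gi_unit(3) by (simp add: sum_subtractf)
    also have "\<dots> = (if re a = -1 then int CARD('a) else 0) - (if re a = 1 then int CARD('a) else 0)"
      unfolding sum_circle_half_angle[OF q4 two] by simp
    also have "re a \<noteq> -1"
    proof
      assume "re a = -1"
      then have "a = of_base (-1)" using unit_circle_real_if_re_square_1[OF unit[OF a]] by simp
      then have "a = -1" by (simp add: gauss_eq_iff)
      then show False using a minus_1_notin_odd_part[OF q] by blast
    qed
    moreover have "re a = 1 \<longleftrightarrow> a = 1"
    proof
      assume "re a = 1"
      then have "a = of_base 1" using unit_circle_real_if_re_square_1[OF unit[OF a]] by simp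
      then show "a = 1" by (simp add: gauss_eq_iff)
    qed simp
    ultimately show "(\<Sum>w\<in>unit_circle. e w * \<chi> (re a + re w)) = (if a = 1 then - int CARD('a) else 0)"
      by simp
  qed
  also have "\<dots> = - int CARD('a)"
    using one_in_odd_part[where 'a = 'a] by simp
  finally show ?thesis using lhs by simp
qed

section \<open>The cosine sum modulo the characteristic\<close>

text \<open>
  The bound is stated for a ring whose freedom from zero divisors is a hypothesis, since
  \<open>'a gauss\<close> has this property only over suitable fields.
\<close>

lemma card_poly_roots_le_degree:
  fixes p :: "'b::{comm_ring_1,finite} poly"
  assumes no_zero_div: "\<And>x y :: 'b. x * y = 0 \<Longrightarrow> x = 0 \<or> y = 0" and "p \<noteq> 0"
  shows "card {x. poly p x = 0} \<le> Polynomial.degree p"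
  using \<open>p \<noteq> 0\<close>
proof (induction "Polynomial.degree p" arbitrary: p rule: less_induct)
  case less
  show ?case
  proof (cases "\<exists>c. poly p c = 0")
    case True
    then obtain c q where p: "p = [:- c, 1:] * q" by (auto simp: poly_eq_0_iff_dvd elim: dvdE)
    have q: "q \<noteq> 0" using less.prems p by auto
    have "Polynomial.coeff p (Suc (Polynomial.degree q)) = lead_coeff q"
      by (simp add: p coeff_eq_0)
    then have "Polynomial.coeff p (Suc (Polynomial.degree q)) \<noteq> 0" using q by simp
    then have deg: "Suc (Polynomial.degree q) \<le> Polynomial.degree p" by (rule le_degree)
    have "{x. poly p x = 0} \<subseteq> insert c {x. poly q x = 0}"
    proof
      fix x assume "x \<in> {x. poly p x = 0}"
      then have "(x - c) * poly q x = 0" by (simp add: p algebra_simps)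
      then show "x \<in> insert c {x. poly q x = 0}" using no_zero_div by force
    qed
    then have "card {x. poly p x = 0} \<le> card (insert c {x. poly q x = 0})"
      by (intro card_mono) auto
    also have "\<dots> \<le> Suc (card {x. poly q x = 0})"
      by (simp add: card_insert_if)
    also have "card {x. poly q x = 0} \<le> Polynomial.degree q"
      using deg q by (intro less.hyps) auto
    finally show ?thesis using deg by simp
  qed simp
qed

lemma card_roots_of_unity_le:
  fixes g :: nat
  assumes "CARD('a::{field,finite}) mod 4 = 3" "g > 0"
  shows "card {z :: 'a gauss. z ^ g = 1} \<le> g"
proof -
  define P where "P = Polynomial.monom (1 :: 'a gauss) g - 1"
  have "Polynomial.coeff P g = 1" using assms(2) by (simp add: P_def)
  then have "P \<noteq> 0" by auto
  then have "card {x. poly P x = 0} \<le> Polynomial.degree P"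
    by (intro card_poly_roots_le_degree gauss_eq_0_if_mult_eq_0[OF assms(1)])
  also have "Polynomial.degree P \<le> g"
    unfolding P_def by (rule degree_diff_le) (auto simp: degree_monom_le)
  finally show ?thesis by (simp add: P_def poly_monom)
qed

lemma card_odd_part:
  assumes pn: "prime p" "CARD('a::{field,finite}) = p ^ n" and q: "CARD('a) mod 8 = 3"
  shows "4 * card (odd_part :: 'a gauss set) = CARD('a) + 1"
proof -
  have q4: "CARD('a) mod 4 = 3" using q by presburger
  note odd = odd_if_3_mod_4[OF q4]
  note two = two_neq_0_if_odd_card[OF odd]
  have ne: "(1::'a) \<noteq> -1"
  proof
    assume "(1::'a) = -1"
    then have "(1::'a) + 1 = 0" by (metis add.right_inverse)
    then show False using two by simp
  qed
  have f: "x ^ 2 - 1 = (x + 1) * (x + -1)" for x :: 'a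
    by (simp add: power2_eq_square algebra_simps)
  have "(\<Sum>w\<in>(unit_circle :: 'a gauss set). 1) = (\<Sum>x\<in>(UNIV :: 'a set). (1 - \<chi> (x ^ 2 - 1)) * 1)"
    by (rule sum_unit_circle[OF q4])
  also have "\<dots> = int CARD('a) - (\<Sum>x\<in>(UNIV :: 'a set). \<chi> (x + 1) * \<chi> (x + -1))"
    unfolding f quad_char_mult[OF odd] by (simp add: sum_subtractf)
  also have "\<dots> = int CARD('a) + 1"
    by (subst sum_quad_char_quadratic[OF odd]) (simp add: ne)
  also have "(\<Sum>w\<in>(unit_circle :: 'a gauss set). 1) = 4 * int (card (odd_part :: 'a gauss set))"
    by (subst sum_unit_circle_decomposition[OF pn q]) simp
  finally show ?thesis by linarith
qed

text \<open>
  If \<open>N\<close> does not divide \<open>e\<close>, some \<open>w\<close> in the odd part has \<open>w ^ e \<noteq> 1\<close>: otherwise all its \<open>N\<close> elements would be roots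
  of \<open>X ^ gcd e N - 1\<close>, where \<open>gcd e N < N\<close>. Multiplication by \<open>w\<close> permutes the odd part, so the sum vanishes.
\<close>

lemma sum_odd_part_power:
  fixes N :: nat
  assumes pn: "prime p" "CARD('a::{field,finite}) = p ^ n" and q: "CARD('a) mod 8 = 3"
    and N: "N = (CARD('a) + 1) div 4"
  shows "(\<Sum>v\<in>(odd_part :: 'a gauss set). v ^ e) = (if N dvd e then of_nat N else 0)"
proof (cases "N dvd e")
  case True
  have "v ^ e = 1" if "v \<in> odd_part" for v :: "'a gauss"
  proof -
    obtain k where "e = N * k" using True by (elim dvdE)
    then show ?thesis using that by (simp add: odd_part_def N power_mult)
  qed
  moreover have "card (odd_part :: 'a gauss set) = N"
    using card_odd_part[OF pn q] by (simp add: N)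
  ultimately show ?thesis using True by simp
next
  case False
  have q4: "CARD('a) mod 4 = 3" using q by presburger
  have cardN: "card (odd_part :: 'a gauss set) = N"
    using card_odd_part[OF pn q] by (simp add: N)
  have N0: "N > 0" using card_odd_part[OF pn q] by (cases "N = 0") (simp_all add: cardN)
  have "\<exists>w\<in>(odd_part :: 'a gauss set). w ^ e \<noteq> 1"
  proof (rule ccontr)
    assume "\<not> ?thesis"
    then have e1: "w ^ e = 1" if "w \<in> odd_part" for w :: "'a gauss" using that by blast
    have "e \<noteq> 0" using False by (metis dvd_0_right)
    then obtain x y where xy: "e * x = N * y + gcd e N" using bezout_nat by blast
    have "(odd_part :: 'a gauss set) \<subseteq> {z. z ^ gcd e N = 1}"
    proof
      fix w :: "'a gauss" assume w: "w \<in> odd_part"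
      have "w ^ (e * x) = 1" using e1[OF w] by (simp add: power_mult)
      moreover have "w ^ (N * y + gcd e N) = w ^ gcd e N"
        using w by (simp add: odd_part_def N power_mult power_add)
      ultimately show "w \<in> {z. z ^ gcd e N = 1}" using xy by simp
    qed
    then have "card (odd_part :: 'a gauss set) \<le> card {z :: 'a gauss. z ^ gcd e N = 1}"
      by (intro card_mono) auto
    also have "\<dots> \<le> gcd e N"
      using N0 by (intro card_roots_of_unity_le[OF q4]) simp
    finally have "N \<le> gcd e N" by (simp add: cardN)
    moreover have "gcd e N dvd N" by simp
    ultimately have "gcd e N = N" using N0 dvd_imp_le by (metis le_antisym)
    then show False using False by (metis gcd_dvd1)
  qed
  then obtain w :: "'a gauss" where w: "w \<in> odd_part" "w ^ e \<noteq> 1" by blast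
  have "(\<Sum>v\<in>odd_part. v ^ e) = (\<Sum>v\<in>odd_part. (w * v) ^ e)"
  proof (rule sum.reindex_bij_witness[of _ "\<lambda>v. w * v" "\<lambda>v. gconj w * v"])
    fix v :: "'a gauss" assume "v \<in> odd_part"
    then show "w * v \<in> odd_part" "gconj w * v \<in> odd_part"
      using w(1) odd_part_mult odd_part_gconj by blast+
    have "gconj w * (w * v) = (w * gconj w) * v" "w * (gconj w * v) = (w * gconj w) * v"
      by (simp_all add: mult_ac)
    then show a: "gconj w * (w * v) = v" and b: "w * (gconj w * v) = v"
      by (simp_all only: odd_part_unit[OF w(1)] mult_1)
    show "(w * (gconj w * v)) ^ e = v ^ e" by (simp only: b)
  qed
  also have "\<dots> = w ^ e * (\<Sum>v\<in>odd_part. v ^ e)"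
    by (simp add: power_mult_distrib sum_distrib_left)
  finally have "(w ^ e - 1) * (\<Sum>v\<in>odd_part. v ^ e) = 0"
    by (simp add: left_diff_distrib)
  then show ?thesis using gauss_eq_0_if_mult_eq_0[OF q4] w(2) False by (metis right_minus_eq)
qed

text \<open>
  By Euler's criterion \<open>\<chi> (re v) = (re v) ^ m\<close> in the field, and \<open>2 re v = v + 1 / v\<close>. In the binomial expansion only the
  powers of \<open>v\<close> with exponent \<open>2 k - m\<close> divisible by \<open>N\<close> survive the summation over the odd part. Since
  \<open>m = 2 N - 1\<close>, the exponent must be \<open>N\<close> or \<open>- N\<close>, and the two binomial coefficients agree.
\<close>

lemma cos_sum_cong_binomial:
  fixes m h :: nat
  assumes pn: "prime p" "CARD('a::{field,finite}) = p ^ n" and q: "CARD('a) mod 8 = 3"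
    and m: "CARD('a) = 2 * m + 1" and h: "CARD('a) = 8 * h + 3"
  shows "of_base ((2::'a) ^ m * of_int (cos_sum (1 :: 'a gauss))) = of_nat (2 * (2 * h + 1) * (m choose h))"
proof -
  have odd: "odd CARD('a)" using m by simp
  define N where "N = (CARD('a) + 1) div 4"
  have Nh: "N = 2 * h + 1" using h by (simp add: N_def)
  have mh: "m = 4 * h + 1" using m h by simp
  have Nm: "m + 1 = 2 * N" using Nh mh by simp
  \<comment> \<open>On the odd part \<open>1 / v = v ^ (N - 1)\<close>, so the exponent \<open>2 k - m\<close> appears as \<open>k + (N - 1) (m - k)\<close>; modulo \<open>N\<close>
    it is \<open>2 k + 1\<close>, an odd number below \<open>4 N\<close>.\<close>
  have dvd_iff: "N dvd k + (N - 1) * (m - k) \<longleftrightarrow> k = h \<or> k = m - h" if "k \<le> m" for k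
  proof -
    obtain l where l: "m = k + l" using \<open>k \<le> m\<close> le_iff_add by blast
    have "k + (N - 1) * l + 2 * N = (2 * k + 1) + N * l"
      using Nm by (simp add: l Nh)
    then have "N dvd k + (N - 1) * l \<longleftrightarrow> N dvd (2 * k + 1)"
      by (metis dvd_add_left_iff dvd_triv_left dvd_triv_right)
    also have "\<dots> \<longleftrightarrow> k = h \<or> k = m - h"
    proof
      assume "N dvd 2 * k + 1"
      then obtain t where t: "2 * k + 1 = N * t" by (elim dvdE)
      have "2 * k + 1 < N * 4" using \<open>k \<le> m\<close> mh Nh by simp
      then have "t < 4" using t by simp
      moreover have "odd t" using t by (metis dvd_triv_right even_mult_iff even_plus_one_iff)
      ultimately have "t = 1 \<or> t = 3" by presburger
      then show "k = h \<or> k = m - h" using t Nh mh by auto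
    next
      assume "k = h \<or> k = m - h"
      then have "2 * k + 1 = N \<or> 2 * k + 1 = N * 3" using Nh mh by auto
      then show "N dvd 2 * k + 1" by (metis dvd_refl dvd_triv_left)
    qed
    finally show ?thesis by (simp add: l)
  qed
  have of_base_int: "of_base (of_int i) = (of_int i :: 'a gauss)" for i
  proof (cases i)
    case (nonneg k)
    then show ?thesis by (simp add: of_nat_gauss)
  next
    case (neg k)
    have "of_base (- x) = - of_base x" for x :: 'a by (simp add: gauss_eq_iff)
    then show ?thesis using neg by (simp add: of_nat_gauss del: of_nat_Suc)
  qed
  have term_eq: "of_base ((2::'a) ^ m) * of_int (\<chi> (re (1 * v)))
      = (\<Sum>k\<le>m. of_nat (m choose k) * v ^ (k + (N - 1) * (m - k)))" if v: "v \<in> odd_part" for v :: "'a gauss"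
  proof -
    have vN: "v ^ N = 1" using v by (simp add: odd_part_def N_def)
    have "v ^ N = v * v ^ (N - 1)" using Nh by simp
    then have "gconj v = gconj v * (v * v ^ (N - 1))" using vN by simp
    also have "\<dots> = (v * gconj v) * v ^ (N - 1)" by (simp only: mult_ac)
    finally have conj: "gconj v = v ^ (N - 1)" using odd_part_unit[OF v] by simp
    have "of_int (\<chi> (re v)) = (re v) ^ m"
      using euler_criterion[OF odd, of "re v"] m by simp
    then have "of_int (\<chi> (re v)) = of_base ((re v) ^ m)"
      by (metis of_base_int)
    then have "of_base ((2::'a) ^ m) * of_int (\<chi> (re (1 * v))) = of_base (2 * re v) ^ m"
      by (simp add: of_base_power of_base_mult power_mult_distrib)
    also have "of_base (2 * re v) = v + gconj v" by (simp add: gauss_eq_iff)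
    also have "(v + gconj v) ^ m = (\<Sum>k\<le>m. of_nat (m choose k) * v ^ k * gconj v ^ (m - k))"
      by (rule binomial_ring)
    finally show ?thesis by (simp add: conj power_add power_mult mult.assoc)
  qed
  have "of_base ((2::'a) ^ m * of_int (cos_sum (1 :: 'a gauss))) = of_base ((2::'a) ^ m) * of_int (cos_sum (1 :: 'a gauss))"
    by (simp only: of_base_mult of_base_int)
  also have "\<dots> = (\<Sum>v\<in>(odd_part :: 'a gauss set). of_base ((2::'a) ^ m) * of_int (\<chi> (re (1 * v))))"
    by (simp only: cos_sum_def of_int_sum sum_distrib_left)
  also have "\<dots> = (\<Sum>v\<in>(odd_part :: 'a gauss set). \<Sum>k\<le>m. of_nat (m choose k) * v ^ (k + (N - 1) * (m - k)))"
    by (rule sum.cong[OF refl]) (rule term_eq)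
  also have "\<dots> = (\<Sum>k\<le>m. of_nat (m choose k) * (\<Sum>v\<in>(odd_part :: 'a gauss set). v ^ (k + (N - 1) * (m - k))))"
    by (subst sum.swap) (simp only: sum_distrib_left)
  also have "\<dots> = (\<Sum>k\<le>m. if k \<in> {h, m - h} then of_nat (m choose k) * of_nat N else 0)"
  proof (rule sum.cong[OF refl])
    fix k assume "k \<in> {..m}"
    then have "N dvd k + (N - 1) * (m - k) \<longleftrightarrow> k \<in> {h, m - h}" using dvd_iff[of k] by simp
    then show "of_nat (m choose k) * (\<Sum>v\<in>(odd_part :: 'a gauss set). v ^ (k + (N - 1) * (m - k)))
        = (if k \<in> {h, m - h} then of_nat (m choose k) * of_nat N else 0)"
      by (simp only: sum_odd_part_power[OF pn q N_def] if_distrib[of "\<lambda>x. _ * x"] mult_zero_right)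
  qed
  also have "\<dots> = (\<Sum>k\<in>{h, m - h}. of_nat (m choose k) * of_nat N)"
    using mh by (subst sum.inter_restrict[symmetric]) (auto intro!: sum.cong)
  also have "\<dots> = of_nat (m choose h) * of_nat N + of_nat (m choose (m - h)) * of_nat N"
    using mh by simp
  also have "m choose (m - h) = m choose h"
    using mh by (intro binomial_symmetric[symmetric]) simp
  finally show ?thesis by (simp add: Nh algebra_simps)
qed

section \<open>Lucas' congruence\<close>

lemma prime_dvd_choose_mult:
  fixes p :: nat
  assumes "prime p" "\<not> p dvd j"
  shows "p dvd ((p * a) choose j)"
proof -
  have "j > 0" using assms(2) by (metis dvd_0_right gr0I)
  then have "j * ((p * a) choose j) = p * (a * ((p * a - 1) choose (j - 1)))"
    using times_binomial_minus1_eq[of j "p * a"] by simp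
  then have "p dvd j * ((p * a) choose j)" by simp
  then show ?thesis using assms prime_dvd_mult_nat by blast
qed

text \<open>
  Induction on the last digit \<open>b\<close> of the upper number, with Pascal's rule. A borrow in \<open>d\<close> can only occur at \<open>d = 0\<close>; it leads to the digit
  \<open>p - 1\<close>, and \<open>b choose (p - 1) = 0\<close> as long as \<open>b + 1 < p\<close>.
\<close>

lemma lucas_step:
  fixes p :: nat
  assumes p: "prime p" and base: "\<And>c. [(p * a) choose (p * c) = a choose c] (mod p)"
    and "b < p" "d < p"
  shows "[(p * a + b) choose (p * c + d) = (a choose c) * (b choose d)] (mod p)"
  using assms(3,4)
proof (induction b arbitrary: c d)
  case 0
  show ?case
  proof (cases "d = 0")
    case True
    then show ?thesis using base by simp
  next
    case False
    then have "\<not> p dvd p * c + d"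
      using 0 by (auto dest: dvd_imp_le simp: dvd_add_right_iff)
    then have "p dvd ((p * a) choose (p * c + d))"
      by (rule prime_dvd_choose_mult[OF p])
    then show ?thesis using False by (simp add: cong_0_iff binomial_eq_0)
  qed
next
  case (Suc b)
  have b: "b < p" using Suc.prems by simp
  show ?case
  proof (cases d)
    case (Suc d')
    have "(p * a + Suc b) choose (p * c + d) = ((p * a + b) choose (p * c + d')) + ((p * a + b) choose (p * c + d))"
      by (simp add: Suc)
    moreover have "[((p * a + b) choose (p * c + d')) + ((p * a + b) choose (p * c + d))
        = (a choose c) * (b choose d') + (a choose c) * (b choose d)] (mod p)"
      by (intro cong_add Suc.IH) (use b Suc.prems Suc in auto)
    ultimately show ?thesis by (simp add: Suc algebra_simps)
  next
    case 0
    show ?thesis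
    proof (cases c)
      case 0
      then show ?thesis using \<open>d = 0\<close> by simp
    next
      case (Suc c')
      have e: "p * c = Suc (p * c' + (p - 1))"
        using prime_gt_0_nat[OF p] by (simp add: Suc)
      have "(p * a + Suc b) choose (p * c + d) = ((p * a + b) choose (p * c' + (p - 1))) + ((p * a + b) choose (p * c + 0))"
        unfolding \<open>d = 0\<close> e by simp
      moreover have "[((p * a + b) choose (p * c' + (p - 1))) + ((p * a + b) choose (p * c + 0))
          = (a choose c') * (b choose (p - 1)) + (a choose c) * (b choose 0)] (mod p)"
        by (intro cong_add Suc.IH) (use b prime_gt_0_nat[OF p] in auto)
      moreover have "b choose (p - 1) = 0"
        using \<open>Suc b < p\<close> by (simp add: binomial_eq_0)
      then have "(a choose c') * (b choose (p - 1)) + (a choose c) * (b choose 0) = (a choose c) * (Suc b choose d)"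
        by (simp add: \<open>d = 0\<close>)
      ultimately show ?thesis by metis
    qed
  qed
qed

text \<open>
  Pascal's rule leads from \<open>p (a + 1)\<close> to \<open>p a + (p - 1)\<close>, where the previous lemma applies for \<open>a\<close>; both
  last-digit coefficients are \<open>1\<close>, and Pascal's rule for \<open>a\<close> recombines the rest.
\<close>

lemma choose_mult_prime_cong:
  fixes p :: nat
  assumes p: "prime p"
  shows "[(p * a) choose (p * c) = a choose c] (mod p)"
proof (induction a arbitrary: c)
  case 0
  then show ?case using prime_gt_0_nat[OF p] by (cases c) (simp_all add: binomial_eq_0)
next
  case (Suc a)
  note step = lucas_step[OF p Suc.IH]
  have p0: "p > 0" using p by (rule prime_gt_0_nat)
  show ?case
  proof (cases c)
    case (Suc c')
    have a: "p * Suc a = Suc (p * a + (p - 1))" and c: "p * Suc c' = Suc (p * c' + (p - 1))"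
      using p0 by simp_all
    have "(p * Suc a) choose (p * c) = ((p * a + (p - 1)) choose (p * c' + (p - 1))) + ((p * a + (p - 1)) choose (p * c + 0))"
      unfolding Suc a c by simp
    moreover have "[((p * a + (p - 1)) choose (p * c' + (p - 1))) + ((p * a + (p - 1)) choose (p * c + 0))
        = (a choose c') * ((p - 1) choose (p - 1)) + (a choose c) * ((p - 1) choose 0)] (mod p)"
      by (intro cong_add step) (use p0 in auto)
    ultimately show ?thesis by (simp add: Suc)
  qed simp
qed

lemma lucas:
  fixes p :: nat
  assumes "prime p" "b < p" "d < p"
  shows "[(p * a + b) choose (p * c + d) = (a choose c) * (b choose d)] (mod p)"
  using assms by (intro lucas_step choose_mult_prime_cong)

lemma not_prime_dvd_choose:
  fixes p :: nat
  assumes "prime p" "d \<le> b" "b < p"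
  shows "\<not> p dvd (b choose d)"
proof
  assume "p dvd (b choose d)"
  then have "p dvd fact d * fact (b - d) * (b choose d)" by simp
  then have "p dvd fact b" by (simp only: binomial_fact_lemma[OF assms(2)])
  then show False using assms by (simp add: prime_dvd_fact_iff)
qed

lemma not_prime_dvd_choose_add_digit:
  fixes p :: nat
  assumes "prime p" "d \<le> b" "b < p" "\<not> p dvd (a choose c)"
  shows "\<not> p dvd ((p * a + b) choose (p * c + d))"
proof -
  have "\<not> p dvd (a choose c) * (b choose d)"
    using assms not_prime_dvd_choose prime_dvd_mult_nat by blast
  then show ?thesis
    using lucas[of p b d a c] assms by (simp add: cong_dvd_iff)
qed

text \<open>
  In base \<open>p = 8 r + 3\<close> all digits of \<open>m = (p\<^sup>n - 1) / 2\<close> are \<open>4 r + 1\<close>, while those of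
  \<open>h = (p\<^sup>n - 3) / 8\<close>, for \<open>n\<close> odd, are \<open>r\<close> and \<open>3 r + 1\<close> in turn. None of the latter exceeds \<open>4 r + 1\<close>, so no factor in
  Lucas' product vanishes. For even exponents, \<open>h\<close> is \<open>(p\<^sup>n - 1) / 8\<close>.
\<close>

lemma not_prime_dvd_choose_half_eighth:
  fixes p :: nat
  assumes p: "prime p" "p mod 8 = 3" and "p ^ (2 * k + 1) = 2 * m + 1" "p ^ (2 * k + 1) = 8 * h + 3"
  shows "\<not> p dvd (m choose h)"
proof -
  define r where "r = p div 8"
  have r: "p = 8 * r + 3" using p(2) mult_div_mod_eq[of 8 p] by (simp add: r_def)
  have even_to_odd: "\<exists>m' h'. p * x = 2 * m' + 1 \<and> p * x = 8 * h' + 3 \<and> \<not> p dvd (m' choose h')"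
    if "x = 2 * m + 1" "x = 8 * h + 1" "\<not> p dvd (m choose h)" for x m h
  proof (intro exI conjI)
    show "p * x = 2 * (p * m + (4 * r + 1)) + 1"
      unfolding that(1) using r by (simp add: algebra_simps)
    show "p * x = 8 * (p * h + r) + 3"
      unfolding that(2) using r by (simp add: algebra_simps)
    show "\<not> p dvd ((p * m + (4 * r + 1)) choose (p * h + r))"
      by (rule not_prime_dvd_choose_add_digit) (use p that r in auto)
  qed
  have odd_to_even: "\<exists>m' h'. p * x = 2 * m' + 1 \<and> p * x = 8 * h' + 1 \<and> \<not> p dvd (m' choose h')"
    if "x = 2 * m + 1" "x = 8 * h + 3" "\<not> p dvd (m choose h)" for x m h
  proof (intro exI conjI)
    show "p * x = 2 * (p * m + (4 * r + 1)) + 1"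
      unfolding that(1) using r by (simp add: algebra_simps)
    show "p * x = 8 * (p * h + (3 * r + 1)) + 1"
      unfolding that(2) using r by (simp add: algebra_simps)
    show "\<not> p dvd ((p * m + (4 * r + 1)) choose (p * h + (3 * r + 1)))"
      by (rule not_prime_dvd_choose_add_digit) (use p that r in auto)
  qed
  have even: "\<exists>m h. p ^ (2 * k) = 2 * m + 1 \<and> p ^ (2 * k) = 8 * h + 1 \<and> \<not> p dvd (m choose h)" for k
  proof (induction k)
    case 0
    have "p ^ (2 * 0) = 2 * 0 + 1 \<and> p ^ (2 * 0) = 8 * 0 + 1 \<and> \<not> p dvd (0 choose 0)"
      using p(1) by auto
    then show ?case by blast
  next
    case (Suc k)
    then obtain m h where "p * p ^ (2 * k) = 2 * m + 1" "p * p ^ (2 * k) = 8 * h + 3" "\<not> p dvd (m choose h)"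
      using even_to_odd by blast
    then have "\<exists>m h. p * (p * p ^ (2 * k)) = 2 * m + 1 \<and> p * (p * p ^ (2 * k)) = 8 * h + 1 \<and> \<not> p dvd (m choose h)"
      by (rule odd_to_even)
    then show ?case by simp
  qed
  obtain m' h' where "p * p ^ (2 * k) = 2 * m' + 1" "p * p ^ (2 * k) = 8 * h' + 3" "\<not> p dvd (m' choose h')"
    using even[of k] even_to_odd by blast
  moreover from this have "m' = m" "h' = h" using assms(3,4) by simp_all
  ultimately show ?thesis by simp
qed

section \<open>Uniqueness of the representation\<close>

text \<open>
  With \<open>Q = p ^ k\<close> the product of \<open>X = a d - b c\<close> and \<open>Y = a d + b c\<close> satisfies \<open>2 X Y = Q (a\<^sup>2 - c\<^sup>2)\<close>. Not both
  factors are divisible by \<open>p\<close>, so \<open>Q\<close> divides one of them. By Brahmagupta's identity \<open>2 X\<^sup>2\<close> and \<open>2 Y\<^sup>2\<close> are at most \<open>Q\<^sup>2\<close>, so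
  the factor that \<open>Q\<close> divides is \<open>0\<close>.
\<close>

lemma square_eq_if_same_norm:
  fixes a b c d :: int
  assumes p: "prime p" "odd p" and ab: "a ^ 2 + 2 * b ^ 2 = p ^ k" and cd: "c ^ 2 + 2 * d ^ 2 = p ^ k"
    and a: "\<not> p dvd a" and c: "\<not> p dvd c"
  shows "a ^ 2 = c ^ 2"
proof (cases "k = 0")
  case True
  have one: "x ^ 2 = 1" if "x ^ 2 + 2 * y ^ 2 = 1" for x y :: int
  proof -
    have "y = 0"
    proof (rule ccontr)
      assume "y \<noteq> 0"
      then have "y ^ 2 > 0" by simp
      then show False using that zero_le_power2[of x] by linarith
    qed
    then show ?thesis using that by simp
  qed
  show ?thesis using one[of a b] one[of c d] ab cd True by simp
next
  case False
  define Q where "Q = p ^ k"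
  have Q0: "Q > 0" using p(1) by (simp add: Q_def prime_gt_0_int)
  define X where "X = a * d - b * c"
  define Y where "Y = a * d + b * c"
  have ab': "a ^ 2 = Q - 2 * b ^ 2" and cd': "c ^ 2 = Q - 2 * d ^ 2"
    using ab cd by (simp_all add: Q_def)
  have XY: "2 * (X * Y) = Q * (a ^ 2 - c ^ 2)"
  proof -
    have "2 * (X * Y) = a ^ 2 * (2 * d ^ 2) - c ^ 2 * (2 * b ^ 2)"
      by (simp add: X_def Y_def power2_eq_square algebra_simps)
    also have "\<dots> = a ^ 2 * (Q - c ^ 2) - c ^ 2 * (Q - a ^ 2)"
      using ab' cd' by simp
    finally show ?thesis by (simp add: algebra_simps)
  qed
  have zero: "x = 0" if "Q dvd x" "y ^ 2 + 2 * x ^ 2 = Q ^ 2" for x y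
  proof (rule ccontr)
    assume "x \<noteq> 0"
    then have "\<bar>Q\<bar> \<le> \<bar>x\<bar>" using that(1) by (rule dvd_imp_le_int)
    then have "Q ^ 2 \<le> x ^ 2" by (simp add: abs_le_square_iff)
    moreover have "Q ^ 2 > 0" using Q0 by simp
    ultimately show False using that(2) zero_le_power2[of y] by linarith
  qed
  have QQ: "Q ^ 2 = (a ^ 2 + 2 * b ^ 2) * (c ^ 2 + 2 * d ^ 2)"
    using ab cd by (simp add: Q_def power2_eq_square)
  have X0: "X = 0" if "Q dvd X"
    by (rule zero[OF that, of "a * c + 2 * (b * d)"]) (unfold QQ, simp add: X_def power2_eq_square algebra_simps)
  have Y0: "Y = 0" if "Q dvd Y"
    by (rule zero[OF that, of "a * c - 2 * (b * d)"]) (unfold QQ, simp add: Y_def power2_eq_square algebra_simps)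
  have np2: "\<not> p dvd 2"
  proof
    assume "p dvd 2"
    then have "p \<le> 2" by (rule zdvd_imp_le) simp
    moreover have "p \<ge> 2" using p(1) by (rule prime_ge_2_int)
    ultimately show False using p(2) by auto
  qed
  have "coprime p 2" using p(1) np2 by (rule prime_imp_coprime)
  then have "coprime Q 2" by (simp add: Q_def)
  moreover have "Q dvd 2 * (X * Y)" using XY by simp
  ultimately have QXY: "Q dvd X * Y" by (simp add: coprime_dvd_mult_right_iff)
  have "\<not> (p dvd X \<and> p dvd Y)"
  proof
    assume "p dvd X \<and> p dvd Y"
    then have "p dvd X + Y" by (simp add: dvd_add)
    then have "p dvd 2 * (a * d)" by (simp add: X_def Y_def)
    then have "p dvd d" using p(1) np2 a by (simp add: prime_dvd_mult_iff)
    moreover have "p dvd Q" using False by (simp add: Q_def)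
    ultimately have "p dvd c ^ 2" unfolding cd' by (simp add: power2_eq_square)
    then show False using p(1) c prime_dvd_power by blast
  qed
  then have "Q dvd X \<or> Q dvd Y"
  proof (cases "p dvd X")
    case True
    with \<open>\<not> (p dvd X \<and> p dvd Y)\<close> have "coprime p Y" using p(1) by (intro prime_imp_coprime) auto
    then have "coprime Q Y" by (simp add: Q_def)
    then show ?thesis using QXY by (simp add: coprime_dvd_mult_left_iff)
  next
    case False
    then have "coprime p X" using p(1) by (intro prime_imp_coprime) auto
    then have "coprime Q X" by (simp add: Q_def)
    then show ?thesis using QXY by (simp add: coprime_dvd_mult_right_iff)
  qed
  then have "X * Y = 0" using X0 Y0 by auto
  then have "Q * (a ^ 2 - c ^ 2) = 0" using XY by linarith
  then show ?thesis using Q0 by simp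
qed

section \<open>Evaluation of the double sum\<close>

lemma odd_square_mod_8:
  assumes "odd (p::nat)"
  shows "p ^ 2 mod 8 = 1"
proof -
  obtain t where t: "p = 2 * t + 1" using assms by (elim oddE)
  have "even (t * (t + 1))" by simp
  then obtain s where "t * (t + 1) = 2 * s" by (elim evenE)
  then have "p ^ 2 = 8 * s + 1" by (simp add: t power2_eq_square algebra_simps)
  then show ?thesis by simp
qed

lemma odd_exponent_if_3_mod_8:
  fixes p :: nat
  assumes "odd p" "p ^ n mod 8 = 3"
  obtains k where "n = 2 * k + 1" "p mod 8 = 3"
proof -
  have sq: "p ^ (2 * k) mod 8 = 1" for k
    using power_mod[of "p ^ 2" 8 k] odd_square_mod_8[OF assms(1)] by (simp add: power_mult)
  have "odd n"
  proof
    assume "even n"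
    then obtain k where "n = 2 * k" by (elim evenE)
    then show False using sq[of k] assms(2) by simp
  qed
  then obtain k where k: "n = 2 * k + 1" by (elim oddE)
  have "p ^ n mod 8 = p * (p ^ (2 * k) mod 8) mod 8"
    by (simp add: k mod_mult_right_eq)
  then have "p mod 8 = 3" using sq[of k] assms(2) by simp
  with k show ?thesis by (rule that)
qed

text \<open>
  Modulo \<open>p\<close> the cosine sum is a unit times a binomial coefficient. The factor \<open>2 (2 h + 1)\<close> is half of
  \<open>q + 1\<close> and hence prime to \<open>p\<close>.
\<close>

lemma not_dvd_cos_sum:
  assumes pn: "prime p" "CARD('a::{field,finite}) = p ^ n" and q: "CARD('a) mod 8 = 3" and p: "odd p"
  shows "\<not> int p dvd cos_sum (1 :: 'a gauss)"
proof
  assume dvd: "int p dvd cos_sum (1 :: 'a gauss)"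
  have char: "CHAR('a) = p" by (rule CHAR_eq_if_card_prime_power[OF pn])
  have "p ^ n mod 8 = 3" using q by (simp only: pn(2))
  then obtain k where k: "n = 2 * k + 1" "p mod 8 = 3"
    using odd_exponent_if_3_mod_8[OF p] by blast
  define h where "h = CARD('a) div 8"
  have h: "CARD('a) = 8 * h + 3"
    using q mult_div_mod_eq[of 8 "CARD('a)"] by (simp add: h_def)
  define m where "m = 4 * h + 1"
  have m: "CARD('a) = 2 * m + 1" using h by (simp add: m_def)
  have "(of_int (cos_sum (1 :: 'a gauss)) :: 'a) = 0"
    using dvd by (simp add: of_int_eq_0_iff_char_dvd char)
  then have "of_nat (2 * (2 * h + 1) * (m choose h)) = (of_base 0 :: 'a gauss)"
    using cos_sum_cong_binomial[OF pn q m h] by simp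
  then have "of_nat (2 * (2 * h + 1) * (m choose h)) = (0 :: 'a gauss)"
    by (simp only: gauss_eq_iff gauss_conj_components gauss_components)
  then have "p dvd 2 * (2 * h + 1) * (m choose h)"
    by (simp only: of_nat_eq_0_iff_char_dvd CHAR_gauss char)
  moreover have "\<not> p dvd 2 * (2 * h + 1)"
  proof
    assume "p dvd 2 * (2 * h + 1)"
    then have "p dvd 2 * (2 * (2 * h + 1))" by (rule dvd_mult)
    also have "2 * (2 * (2 * h + 1)) = p ^ n + 1" using h unfolding pn(2) by simp
    finally have "p dvd p ^ n + 1" .
    moreover have "p dvd p ^ n" using k(1) by simp
    ultimately have "p dvd 1" using dvd_add_right_iff[of p "p ^ n" 1] by blast
    then show False using pn(1) by (simp add: prime_nat_iff)
  qed
  moreover have "\<not> p dvd (m choose h)"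
    by (rule not_prime_dvd_choose_half_eighth[OF pn(1) k(2)]) (use m h pn(2) k(1) in simp_all)
  ultimately show False using pn(1) prime_dvd_mult_nat by blast
qed

lemma double_sum_3_mod_8:
  assumes pn: "prime p" "CARD('a::{field,finite}) = p ^ n" and q: "CARD('a) mod 8 = 3" and p: "odd p"
  obtains A B :: int where "A ^ 2 + 2 * B ^ 2 = int CARD('a)" "\<not> int p dvd A"
    "(\<Sum>j\<in>UNIV - {0::'a}. \<Sum>x\<in>UNIV - {0::'a}.
        \<chi> (j * x) * \<chi> (1 - x) * \<chi> (x * (j + 1) ^ 2 + (j - 1) ^ 2)) = 4 * A ^ 2 - 2 * int CARD('a)"
proof -
  have q4: "CARD('a) mod 4 = 3" using q by presburger
  have two: "\<chi> (2::'a) = -1" using quad_char_2[OF pn q4] q by simp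
  obtain z :: "'a gauss" where z: "z * z = gi" "z * gconj z = -1"
    using eighth_root_exists[OF q4 two] by blast
  have norm: "cos_sum (1::'a gauss) ^ 2 + 2 * cos_sum z ^ 2 = int CARD('a)"
    by (rule card_eq_cos_sums[OF pn q two z])
  show ?thesis
  proof (rule that[OF norm not_dvd_cos_sum[OF pn q p]])
    show "(\<Sum>j\<in>UNIV - {0::'a}. \<Sum>x\<in>UNIV - {0::'a}.
        \<chi> (j * x) * \<chi> (1 - x) * \<chi> (x * (j + 1) ^ 2 + (j - 1) ^ 2))
        = 4 * cos_sum (1::'a gauss) ^ 2 - 2 * int CARD('a)"
      unfolding double_sum_eq_legendre_moment[OF q4] legendre_moment_eq_cos_sums[OF pn q two z] two
      using norm by simp
  qed
qed

lemma double_sum_7_mod_8: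
  assumes pn: "prime p" "CARD('a::{field,finite}) = p ^ n" and q: "CARD('a) mod 8 = 7"
  shows "(\<Sum>j\<in>UNIV - {0::'a}. \<Sum>x\<in>UNIV - {0::'a}.
        \<chi> (j * x) * \<chi> (1 - x) * \<chi> (x * (j + 1) ^ 2 + (j - 1) ^ 2)) = 2 * int CARD('a)"
proof -
  have q4: "CARD('a) mod 4 = 3" using q by presburger
  have two: "\<chi> (2::'a) = 1" using quad_char_2[OF pn q4] q by simp
  then have "legendre_moment TYPE('a) = 0" using legendre_moment_eq[OF q4] by simp
  then show ?thesis by (simp add: double_sum_eq_legendre_moment[OF q4] two)
qed

lemma odd_int_square_mod_8:
  assumes "odd (x::int)"
  shows "[x ^ 2 = 1] (mod 8)"
proof -
  obtain t where t: "x = 2 * t + 1" using assms by (elim oddE)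
  have "even (t * (t + 1))" by simp
  then obtain s where "t * (t + 1) = 2 * s" by (elim evenE)
  then have "x ^ 2 = 8 * s + 1" by (simp add: t power2_eq_square algebra_simps)
  then show ?thesis by (simp add: cong_def)
qed

theorem theorem5p5:
  fixes p q n :: nat and Z :: int
  assumes "prime p" and "odd p" and "n > 0" and "q = p ^ n"
    and "CARD('a::{field,finite}) = q"
    and Z: "Z = (\<Sum>j\<in>UNIV - {0::'a}. \<Sum>x\<in>UNIV - {0::'a}.
               quad_char (j * x) * quad_char (1 - x)
               * quad_char (x * (j + 1) ^ 2 + (j - 1) ^ 2))"
  shows "([q = 7] (mod 8) \<longrightarrow> Z = 2 * int q)
       \<and> ([q = 3] (mod 8) \<longrightarrow>
           (\<exists>!(a::nat, b::nat). 0 < a \<and> 0 < b \<and> \<not> p dvd a \<and> q ^ 2 = a ^ 2 + 2 * b ^ 2)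
         \<and> (\<forall>a b :: nat. 0 < a \<and> 0 < b \<and> \<not> p dvd a \<and> q ^ 2 = a ^ 2 + 2 * b ^ 2 \<longrightarrow>
              (\<exists>!u::int. \<bar>u\<bar> = int a \<and> [u = - 1] (mod 8))
            \<and> (\<forall>u::int. \<bar>u\<bar> = int a \<and> [u = - 1] (mod 8) \<longrightarrow> Z = 2 * u)))
       \<and> (q = p \<and> [p = 3] (mod 8) \<longrightarrow>
           (\<exists>a b :: int. int p = a ^ 2 + 2 * b ^ 2)
         \<and> (\<forall>a b :: int. int p = a ^ 2 + 2 * b ^ 2 \<longrightarrow> Z = 4 * a ^ 2 - 2 * int p))"
proof -
  have pn: "prime p" "CARD('a) = p ^ n" using assms by simp_all
  have p_int: "prime (int p)" "odd (int p)" using assms(1,2) by simp_all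
  have p2: "\<not> int p dvd 2"
  proof
    assume "int p dvd 2"
    then have "int p \<le> 2" by (rule zdvd_imp_le) simp
    moreover have "int p \<ge> 2" using p_int(1) by (rule prime_ge_2_int)
    ultimately show False using p_int(2) by auto
  qed
  have dvd_if_dvd_twice_square: "int p dvd x" if "int p dvd 2 * x ^ 2" for x :: int
  proof -
    have "int p dvd x ^ 2" using that p2 by (simp only: prime_dvd_mult_iff[OF p_int(1)] simp_thms)
    then show ?thesis by (rule prime_dvd_power[OF p_int(1)])
  qed
  have p_dvd_q: "int p dvd int q" using assms(3,4) by simp
  have seven: "Z = 2 * int q" if "[q = 7] (mod 8)"
    using double_sum_7_mod_8[OF pn] that assms(5) Z by (simp add: cong_def)
  have rep: "\<exists>A B. A ^ 2 + 2 * B ^ 2 = int q \<and> \<not> int p dvd A \<and> Z = 4 * A ^ 2 - 2 * int q"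
    if "[q = 3] (mod 8)"
  proof -
    have "CARD('a) mod 8 = 3" using that assms(5) by (simp add: cong_def)
    from double_sum_3_mod_8[OF pn this assms(2)] show ?thesis
      unfolding assms(5) Z[symmetric] by metis
  qed
  have three: "(\<exists>!(a::nat, b::nat). 0 < a \<and> 0 < b \<and> \<not> p dvd a \<and> q ^ 2 = a ^ 2 + 2 * b ^ 2)
         \<and> (\<forall>a b :: nat. 0 < a \<and> 0 < b \<and> \<not> p dvd a \<and> q ^ 2 = a ^ 2 + 2 * b ^ 2 \<longrightarrow>
              (\<exists>!u::int. \<bar>u\<bar> = int a \<and> [u = - 1] (mod 8))
            \<and> (\<forall>u::int. \<bar>u\<bar> = int a \<and> [u = - 1] (mod 8) \<longrightarrow> Z = 2 * u))"
    if q3: "[q = 3] (mod 8)"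
  proof -
    obtain A B where AB: "A ^ 2 + 2 * B ^ 2 = int q" "\<not> int p dvd A" "Z = 4 * A ^ 2 - 2 * int q"
      using rep[OF q3] by blast
    define u where "u = 2 * A ^ 2 - int q"
    define v where "v = 2 * A * B"
    have Zu: "Z = 2 * u" by (simp add: u_def AB(3))
    have uv: "u ^ 2 + 2 * v ^ 2 = int q ^ 2"
      by (simp add: u_def v_def AB(1)[symmetric] power2_eq_square algebra_simps)
    have pu: "\<not> int p dvd u"
    proof
      assume "int p dvd u"
      then have "int p dvd u + int q" using p_dvd_q by (rule dvd_add)
      then have "int p dvd 2 * A ^ 2" by (simp add: u_def)
      then show False using dvd_if_dvd_twice_square AB(2) by blast
    qed
    have "q mod 8 = 3" using q3 by (simp add: cong_def)
    then have q8: "int q mod 8 = 3" using zmod_int[of q 8] by simp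
    have "odd (int q)" using q8 by presburger
    then have "odd (A ^ 2)" by (simp add: AB(1)[symmetric])
    then have "odd A" by simp
    then have A8: "[A ^ 2 = 1] (mod 8)" by (rule odd_int_square_mod_8)
    have u8: "[u = -1] (mod 8)"
    proof -
      have "[2 * A ^ 2 - int q = 2 * 1 - 3] (mod 8)"
        by (intro cong_diff cong_mult A8) (use q8 in \<open>simp_all add: cong_def\<close>)
      then show ?thesis by (simp add: u_def)
    qed
    have "B \<noteq> 0"
    proof
      assume "B = 0"
      then have "A ^ 2 = int q" using AB(1) by simp
      then show False using A8 q8 by (simp add: cong_def)
    qed
    have u0: "u \<noteq> 0" using pu by auto
    have v0: "v \<noteq> 0" using \<open>B \<noteq> 0\<close> \<open>odd A\<close> by (auto simp: v_def)
    have unique: "int a = \<bar>u\<bar> \<and> int b = \<bar>v\<bar>" if "\<not> p dvd a" "q ^ 2 = a ^ 2 + 2 * b ^ 2" for a b :: nat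
    proof -
      have ab: "int a ^ 2 + 2 * int b ^ 2 = int q ^ 2"
        using that(2) by (metis of_nat_add of_nat_mult of_nat_numeral of_nat_power)
      have qp: "int q ^ 2 = int p ^ (n * 2)" by (simp add: assms(4) power_mult)
      have "int a ^ 2 = u ^ 2"
      proof (rule square_eq_if_same_norm[OF p_int])
        show "int a ^ 2 + 2 * int b ^ 2 = int p ^ (n * 2)" using ab qp by simp
        show "u ^ 2 + 2 * v ^ 2 = int p ^ (n * 2)" using uv qp by simp
        show "\<not> int p dvd int a" using that(1) by simp
      qed (rule pu)
      moreover from this have "int b ^ 2 = v ^ 2" using ab uv by simp
      ultimately have "\<bar>int a\<bar> = \<bar>u\<bar>" "\<bar>int b\<bar> = \<bar>v\<bar>"
        by (simp_all only: power2_eq_iff abs_eq_iff)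
      then show ?thesis by simp
    qed
    have exists: "0 < nat \<bar>u\<bar> \<and> 0 < nat \<bar>v\<bar> \<and> \<not> p dvd nat \<bar>u\<bar> \<and> q ^ 2 = nat \<bar>u\<bar> ^ 2 + 2 * nat \<bar>v\<bar> ^ 2"
    proof (intro conjI)
      show "\<not> p dvd nat \<bar>u\<bar>"
      proof
        assume "p dvd nat \<bar>u\<bar>"
        then have "int p dvd int (nat \<bar>u\<bar>)" by (simp only: of_nat_dvd_iff)
        then show False using pu by simp
      qed
      have "int (q ^ 2) = int (nat \<bar>u\<bar> ^ 2 + 2 * nat \<bar>v\<bar> ^ 2)"
        using uv by simp
      then show "q ^ 2 = nat \<bar>u\<bar> ^ 2 + 2 * nat \<bar>v\<bar> ^ 2" by (simp only: of_nat_eq_iff)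
    qed (use u0 v0 in simp_all)
    show ?thesis
    proof (intro conjI allI impI)
      show "\<exists>!(a::nat, b::nat). 0 < a \<and> 0 < b \<and> \<not> p dvd a \<and> q ^ 2 = a ^ 2 + 2 * b ^ 2"
      proof (rule ex1I[of _ "(nat \<bar>u\<bar>, nat \<bar>v\<bar>)"])
        fix ab assume "case ab of (a, b) \<Rightarrow> 0 < a \<and> 0 < b \<and> \<not> p dvd a \<and> q ^ 2 = a ^ 2 + 2 * b ^ 2"
        then show "ab = (nat \<bar>u\<bar>, nat \<bar>v\<bar>)"
          using unique[of "fst ab" "snd ab"] by (cases ab) auto
      qed (use exists in simp)
    next
      fix a b :: nat assume ab: "0 < a \<and> 0 < b \<and> \<not> p dvd a \<and> q ^ 2 = a ^ 2 + 2 * b ^ 2"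
      then have a: "int a = \<bar>u\<bar>" using unique by blast
      have only: "w = u" if "\<bar>w\<bar> = int a \<and> [w = - 1] (mod 8)" for w
      proof (rule ccontr)
        assume "w \<noteq> u"
        then have "w = - u" using that a by linarith
        then have "[- u = -1] (mod 8)" using that by simp
        then have "[(- u) + u = -1 + -1] (mod 8)" using u8 by (rule cong_add)
        then show False by (simp add: cong_def)
      qed
      show "\<exists>!u::int. \<bar>u\<bar> = int a \<and> [u = - 1] (mod 8)"
      proof (rule ex1I)
        show "\<bar>u\<bar> = int a \<and> [u = - 1] (mod 8)" using a u8 by simp
      qed (rule only)
      show "Z = 2 * w" if "\<bar>w\<bar> = int a \<and> [w = - 1] (mod 8)" for w
        using only[OF that] Zu by simp
    qed
  qed
  have prime_case: "(\<exists>a b :: int. int p = a ^ 2 + 2 * b ^ 2)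
         \<and> (\<forall>a b :: int. int p = a ^ 2 + 2 * b ^ 2 \<longrightarrow> Z = 4 * a ^ 2 - 2 * int p)"
    if qp: "q = p" and p3: "[p = 3] (mod 8)"
  proof -
    obtain A B where AB: "A ^ 2 + 2 * B ^ 2 = int p" "\<not> int p dvd A" "Z = 4 * A ^ 2 - 2 * int p"
      using rep p3 unfolding qp by blast
    have "Z = 4 * a ^ 2 - 2 * int p" if ab: "int p = a ^ 2 + 2 * b ^ 2" for a b :: int
    proof -
      have "\<not> int p dvd a"
      proof
        assume dvd_a: "int p dvd a"
        then have "int p dvd a ^ 2" by (simp add: power2_eq_square)
        then have "int p dvd int p - a ^ 2" by (intro dvd_diff) simp_all
        then have "int p dvd 2 * b ^ 2" using ab by simp
        then have dvd_b: "int p dvd b" by (rule dvd_if_dvd_twice_square)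
        have "int p ^ 2 dvd a ^ 2 + 2 * b ^ 2"
          using dvd_a dvd_b by (intro dvd_add dvd_mult dvd_power_same)
        then have "int p * int p dvd int p * 1"
          using ab by (simp add: power2_eq_square)
        then have "int p dvd 1" using p_int(1) by (metis dvd_times_left_cancel_iff not_prime_0)
        then show False using p_int(1) not_prime_unit by blast
      qed
      then have "a ^ 2 = A ^ 2"
        by (intro square_eq_if_same_norm[OF p_int, where k = 1]) (use ab AB in auto)
      then show ?thesis using AB(3) by simp
    qed
    then show ?thesis using AB(1) by metis
  qed
  show ?thesis using seven three prime_case by blast
qed

end
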